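(* Let $n,k$ be positive integers, $T$ a UCPT$(n)$-Schur multiplier and $S$ a UCPT$(k)$-Schur multiplier. Then $$d_{\mathrm{cb}}\big(T\otimes S,\mathrm{conv}(\mathrm{Aut}(M_{nk}(\mathbb{C})))\big)\geq \tfrac12\, d_{\mathrm{cb}}\big(T,\mathrm{conv}(\mathrm{Aut}(M_n(\mathbb{C})))\big).$$ In particular, if $T\notin\mathrm{conv}(\mathrm{Aut}(M_n(\mathbb{C})))$, then $T$ fails the asymptotic quantum Birkhoff property.
   Context: A UCPT$(n)$-map is a unital completely positive trace-preserving linear map on $M_n(\mathbb{C})$. A UCPT$(n)$-Schur multiplier is a UCPT$(n)$-map of the form $x=(x_{ij})\mapsto(b_{ij}x_{ij})$ for a fixed matrix $(b_{ij})$. $\mathrm{Aut}(M_m(\mathbb{C}))$ is the set of maps $x\mapsto u^*xu$ with $u$ unitary, $\mathrm{conv}$ denotes convex hull, $M_n(\mathbb{C})\otimes M_k(\mathbb{C})$ is identified with $M_{nk}(\mathbb{C})$, and $d_{\mathrm{cb}}(T,\mathcal{C})=\inf_{R\in\mathcal{C}}\|T-R\|_{\mathrm{cb}}$. A UCPT$(n)$-map $T$ satisfies the asymptotic quantum Birkhoff property if $\lim_{k\to\infty} d_{\mathrm{cb}}\big(T^{\otimes k},\mathrm{conv}(\mathrm{Aut}(M_{n^k}(\mathbb{C})))\big)=0$. *)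

theory Defs
  imports Complex_Main "Jordan_Normal_Form.Matrix"
begin

text \<open>Matrices in M_d(C) are complex matrices in carrier_mat d d.
  Linear maps on M_d(C) are functions complex mat to complex mat; only their
  values on carrier_mat d d matter.\<close>

definition ctrans :: "complex mat \<Rightarrow> complex mat" where
  "ctrans A = mat (dim_col A) (dim_row A) (\<lambda>(i,j). cnj (A $$ (j,i)))"

definition unitary_mat :: "nat \<Rightarrow> complex mat \<Rightarrow> bool" where
  "unitary_mat d U \<longleftrightarrow> U \<in> carrier_mat d d \<and> ctrans U * U = 1\<^sub>m d \<and> U * ctrans U = 1\<^sub>m d"

definition psd_mat :: "nat \<Rightarrow> complex mat \<Rightarrow> bool" where
  "psd_mat d A \<longleftrightarrow> A \<in> carrier_mat d d \<and>
     (\<forall>v \<in> carrier_vec d. let z = (\<Sum>i<d. cnj (v $ i) * (A *\<^sub>v v) $ i) in Im z = 0 \<and> Re z \<ge> 0)"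

definition mtrace :: "complex mat \<Rightarrow> complex" where
  "mtrace A = (\<Sum>i<dim_row A. A $$ (i,i))"

definition munit :: "nat \<Rightarrow> nat \<Rightarrow> nat \<Rightarrow> complex mat" where
  "munit d i j = mat d d (\<lambda>(a,b). if a = i \<and> b = j then 1 else 0)"

text \<open>Kronecker product, identifying M_n \<otimes> M_k with M_(nk) via (i,p) \<mapsto> i*k+p.\<close>
definition kron :: "complex mat \<Rightarrow> complex mat \<Rightarrow> complex mat" where
  "kron A B = mat (dim_row A * dim_row B) (dim_col A * dim_col B)
     (\<lambda>(r,c). A $$ (r div dim_row B, c div dim_col B) * B $$ (r mod dim_row B, c mod dim_col B))"

text \<open>Tensor product T \<otimes> S of maps on M_n and M_k, as a (linear) map on M_(nk):
  the linear map sending E_ij \<otimes> E_pq to T(E_ij) \<otimes> S(E_pq).\<close>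
definition tensor_map :: "nat \<Rightarrow> nat \<Rightarrow> (complex mat \<Rightarrow> complex mat) \<Rightarrow> (complex mat \<Rightarrow> complex mat)
    \<Rightarrow> complex mat \<Rightarrow> complex mat" where
  "tensor_map n k T S x = mat (n*k) (n*k) (\<lambda>(r,c).
     \<Sum>i<n. \<Sum>j<n. \<Sum>p<k. \<Sum>q<k. x $$ (i*k+p, j*k+q) * kron (T (munit n i j)) (S (munit k p q)) $$ (r,c))"

fun tensor_pow :: "nat \<Rightarrow> nat \<Rightarrow> (complex mat \<Rightarrow> complex mat) \<Rightarrow> complex mat \<Rightarrow> complex mat" where
  "tensor_pow n 0 T = (\<lambda>x. x)"
| "tensor_pow n (Suc k) T = tensor_map n (n^k) T (tensor_pow n k T)"

definition linear_on :: "nat \<Rightarrow> (complex mat \<Rightarrow> complex mat) \<Rightarrow> bool" where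
  "linear_on d T \<longleftrightarrow> (\<forall>x\<in>carrier_mat d d. T x \<in> carrier_mat d d) \<and>
     (\<forall>x\<in>carrier_mat d d. \<forall>y\<in>carrier_mat d d. \<forall>a b. T (a \<cdot>\<^sub>m x + b \<cdot>\<^sub>m y) = a \<cdot>\<^sub>m T x + b \<cdot>\<^sub>m T y)"

definition completely_positive :: "nat \<Rightarrow> (complex mat \<Rightarrow> complex mat) \<Rightarrow> bool" where
  "completely_positive d T \<longleftrightarrow>
     (\<forall>m. \<forall>X. psd_mat (m*d) X \<longrightarrow> psd_mat (m*d) (tensor_map m d (\<lambda>x. x) T X))"

definition UCPT :: "nat \<Rightarrow> (complex mat \<Rightarrow> complex mat) \<Rightarrow> bool" where
  "UCPT d T \<longleftrightarrow> linear_on d T \<and> T (1\<^sub>m d) = 1\<^sub>m d \<and> completely_positive d T \<and>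
     (\<forall>x\<in>carrier_mat d d. mtrace (T x) = mtrace x)"

definition UCPT_schur :: "nat \<Rightarrow> (complex mat \<Rightarrow> complex mat) \<Rightarrow> bool" where
  "UCPT_schur d T \<longleftrightarrow> UCPT d T \<and>
     (\<exists>b\<in>carrier_mat d d. \<forall>x\<in>carrier_mat d d. T x = mat d d (\<lambda>(i,j). b $$ (i,j) * x $$ (i,j)))"

definition vnorm :: "complex vec \<Rightarrow> real" where
  "vnorm v = sqrt (\<Sum>i<dim_vec v. (cmod (v $ i))\<^sup>2)"

definition opnorm :: "complex mat \<Rightarrow> real" where
  "opnorm A = Sup {vnorm (A *\<^sub>v v) | v. v \<in> carrier_vec (dim_col A) \<and> vnorm v \<le> 1}"

definition map_norm :: "nat \<Rightarrow> (complex mat \<Rightarrow> complex mat) \<Rightarrow> real" where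
  "map_norm d T = Sup {opnorm (T X) | X. X \<in> carrier_mat d d \<and> opnorm X \<le> 1}"

definition cb_norm :: "nat \<Rightarrow> (complex mat \<Rightarrow> complex mat) \<Rightarrow> real" where
  "cb_norm d T = Sup {map_norm (m*d) (tensor_map m d (\<lambda>x. x) T) | m. m \<ge> 1}"

definition conv_aut :: "nat \<Rightarrow> (complex mat \<Rightarrow> complex mat) set" where
  "conv_aut d = {R. \<exists>N (lam :: nat \<Rightarrow> real) U.
      (\<forall>l<N. lam l \<ge> 0 \<and> unitary_mat d (U l)) \<and> (\<Sum>l<N. lam l) = 1 \<and>
      R = (\<lambda>x. mat d d (\<lambda>ij. \<Sum>l<N. complex_of_real (lam l) * (ctrans (U l) * x * U l) $$ ij))}"

definition d_cb :: "nat \<Rightarrow> (complex mat \<Rightarrow> complex mat) \<Rightarrow> (complex mat \<Rightarrow> complex mat) set \<Rightarrow> real" where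
  "d_cb d T C = Inf {cb_norm d (\<lambda>x. T x - R x) | R. R \<in> C}"

definition in_conv_aut :: "nat \<Rightarrow> (complex mat \<Rightarrow> complex mat) \<Rightarrow> bool" where
  "in_conv_aut d T \<longleftrightarrow> (\<exists>R\<in>conv_aut d. \<forall>x\<in>carrier_mat d d. T x = R x)"

definition asymptotic_QBP :: "nat \<Rightarrow> (complex mat \<Rightarrow> complex mat) \<Rightarrow> bool" where
  "asymptotic_QBP n T \<longleftrightarrow> (\<lambda>k. d_cb (n^k) (tensor_pow n k T) (conv_aut (n^k))) \<longlonglongrightarrow> 0"

end

theory Submission
  imports Defs "HOL-Analysis.L2_Norm" "Jordan_Normal_Form.Determinant"
begin

text \<open>
  Let R be a mixture of the automorphisms Ad(U), U in a finite set, at cb-distance \<delta> from T \<otimes> S. As S fixes the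
  (0,0) entry of the matrix unit E_00, compressing by the isometry V : v \<mapsto> v \<otimes> e_0 turns T \<otimes> S into T and R
  into the mixture R_V of the maps x \<mapsto> A*xA (stars are adjoints) with contractions A = V*UV, and T is still \<delta>-close to R_V.
  By the singular value decomposition A = (W + W')/2 with unitaries W, W' = A \<plusminus> iB, so that
  A*xA is the mean of W*xW and W'*xW' minus B*xB, where B*B = 1 - A*A. Hence R_V = R' - \<Phi> with R' a
  mixture of automorphisms of M_n and \<Phi> completely positive, and the cb-norm of \<Phi> is the norm of
  \<Phi>(1) = 1 - R_V(1) = (T - R_V)(1), which is at most \<delta>. So T is within 2\<delta> of R'.

  If T has the asymptotic quantum Birkhoff property, the estimate applied to T and its tensor
  powers makes the distance from T to conv(Aut) zero, and conv(Aut) is closed by Caratheodory's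
  theorem and compactness of the unitary group.
\<close>

section \<open>Sesquilinear forms and completely bounded maps\<close>

text \<open>The obstacle is that the compression of a unitary is only a contraction, so R_V need not
  be unital and may lie outside conv(Aut). The repair costs the norm of the defect 1 - R_V(1), and
  T(1) = 1 turns this defect into a value of T - R_V. One \<delta> for T - R_V and one for \<Phi>
  give the constant 2, hence the factor 1/2. Since the constant does not depend on k, the estimate
  bounds all tensor powers of T from below at once. The norms are real-valued \<open>Sup\<close> and
  \<open>Inf\<close>, meaningful only for nonempty bounded sets. The argument therefore runs on the
  predicates \<open>form_bound\<close> and \<open>cb_bound\<close>, which quantify over all vectors
  and all amplifications; \<open>cb_bound_exists\<close> supplies the finiteness that translates
  them back in \<open>cb_norm_le_iff\<close>. Compactness controls mixtures of a fixed number of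
  unitaries, whereas \<open>conv_aut\<close> admits any number; Caratheodory's theorem closes this
  gap.\<close>

definition nrm :: "nat \<Rightarrow> (nat \<Rightarrow> complex) \<Rightarrow> real" where
  "nrm N u = L2_set (\<lambda>i. cmod (u i)) {..<N}"

definition sform :: "nat \<Rightarrow> (nat \<Rightarrow> complex) \<Rightarrow> (nat \<Rightarrow> nat \<Rightarrow> complex) \<Rightarrow> (nat \<Rightarrow> complex) \<Rightarrow> complex" where
  "sform N u a v = (\<Sum>i<N. \<Sum>j<N. cnj (u i) * a i j * v j)"

text \<open>This is "operator norm at most c" without a supremum. Vectors and matrices are functions
  of which only the indices below \<open>N\<close> count, so that blocks, slices and reindexings are
  plain lambda terms.\<close>

definition form_bound :: "nat \<Rightarrow> (nat \<Rightarrow> nat \<Rightarrow> complex) \<Rightarrow> real \<Rightarrow> bool" where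
  "form_bound N a c \<longleftrightarrow> (\<forall>u v. cmod (sform N u a v) \<le> c * nrm N u * nrm N v)"

text \<open>A linear map T on M_d is encoded by the family t p q r s of the (r,s) entries of T(E_pq);
  amp d t is then id \<otimes> T on M_m \<otimes> M_d for every m, with the index convention of the Kronecker product.\<close>

definition amp :: "nat \<Rightarrow> (nat \<Rightarrow> nat \<Rightarrow> nat \<Rightarrow> nat \<Rightarrow> complex) \<Rightarrow> (nat \<Rightarrow> nat \<Rightarrow> complex) \<Rightarrow> nat \<Rightarrow> nat \<Rightarrow> complex" where
  "amp d t x i j = (\<Sum>p<d. \<Sum>q<d. x (i div d * d + p) (j div d * d + q) * t p q (i mod d) (j mod d))"

definition cb_bound :: "nat \<Rightarrow> (nat \<Rightarrow> nat \<Rightarrow> nat \<Rightarrow> nat \<Rightarrow> complex) \<Rightarrow> real \<Rightarrow> bool" where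
  "cb_bound d t c \<longleftrightarrow> (\<forall>m\<ge>1. \<forall>x. form_bound (m*d) x 1 \<longrightarrow> form_bound (m*d) (amp d t x) c)"

text \<open>The operator 1 \<otimes> B on C^m \<otimes> C^d: it acts on each block of length
  \<open>d\<close>, so one formula serves every m.\<close>

definition lift :: "nat \<Rightarrow> (nat \<Rightarrow> nat \<Rightarrow> complex) \<Rightarrow> (nat \<Rightarrow> complex) \<Rightarrow> nat \<Rightarrow> complex" where
  "lift d B u i = (\<Sum>r<d. B (i mod d) r * u (i div d * d + r))"

lemma nrm_nonneg [simp]: "0 \<le> nrm N u"
  by (simp add: nrm_def)

lemma nrm_sq: "(nrm N u)\<^sup>2 = (\<Sum>i<N. (cmod (u i))\<^sup>2)"
  by (simp add: nrm_def L2_set_def sum_nonneg)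

lemma nrm_cong: "(\<And>i. i < N \<Longrightarrow> u i = v i) \<Longrightarrow> nrm N u = nrm N v"
  unfolding nrm_def by (rule L2_set_cong) auto

lemma sum_index_split:
  "(\<Sum>i<m*d. f i) = (\<Sum>a<m. \<Sum>r<d. f (a * d + r))" for f :: "nat \<Rightarrow> 'a::comm_monoid_add"
proof -
  have "sum f {a*d..<a*d+d} = (\<Sum>r<d. f (a * d + r))" for a
    using sum.shift_bounds_nat_ivl[of f 0 "a*d" d] by (simp add: add.commute lessThan_atLeast0)
  then show ?thesis by (simp flip: sum.nat_group)
qed

lemma sum4_swap:
  "(\<Sum>r\<in>R. \<Sum>s\<in>S. \<Sum>p\<in>P. \<Sum>q\<in>Q. f r s p q) = (\<Sum>p\<in>P. \<Sum>q\<in>Q. \<Sum>r\<in>R. \<Sum>s\<in>S. f r s p q)"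
  for f :: "_ \<Rightarrow> _ \<Rightarrow> _ \<Rightarrow> _ \<Rightarrow> 'a::comm_monoid_add"
proof -
  have "(\<Sum>r\<in>R. \<Sum>s\<in>S. \<Sum>p\<in>P. \<Sum>q\<in>Q. f r s p q) = (\<Sum>r\<in>R. \<Sum>p\<in>P. \<Sum>q\<in>Q. \<Sum>s\<in>S. f r s p q)"
    by (rule sum.cong[OF refl], subst sum.swap, rule sum.cong[OF refl], rule sum.swap)
  also have "\<dots> = (\<Sum>p\<in>P. \<Sum>q\<in>Q. \<Sum>r\<in>R. \<Sum>s\<in>S. f r s p q)"
    by (subst sum.swap, rule sum.cong[OF refl], rule sum.swap)
  finally show ?thesis .
qed

lemma sform_cong:
  "\<lbrakk>\<And>i. i < N \<Longrightarrow> u i = u' i; \<And>i j. i < N \<Longrightarrow> j < N \<Longrightarrow> a i j = a' i j; \<And>i. i < N \<Longrightarrow> v i = v' i\<rbrakk>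
    \<Longrightarrow> sform N u a v = sform N u' a' v'"
  unfolding sform_def by (intro sum.cong) auto

lemma form_bound_cong:
  assumes "\<And>i j. i < N \<Longrightarrow> j < N \<Longrightarrow> a i j = a' i j"
  shows "form_bound N a c = form_bound N a' c"
proof -
  have "sform N u a v = sform N u a' v" for u v
    by (rule sform_cong) (simp_all add: assms)
  then show ?thesis by (simp add: form_bound_def)
qed

lemma sform_sum: "sform N u (\<lambda>i j. \<Sum>l\<in>L. c l * a l i j) v = (\<Sum>l\<in>L. c l * sform N u (a l) v)"
proof -
  have "sform N u (\<lambda>i j. \<Sum>l\<in>L. c l * a l i j) v
      = (\<Sum>i<N. \<Sum>j<N. \<Sum>l\<in>L. c l * (cnj (u i) * a l i j * v j))"
    unfolding sform_def by (simp add: sum_distrib_left sum_distrib_right mult_ac)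
  also have "\<dots> = (\<Sum>i<N. \<Sum>l\<in>L. \<Sum>j<N. c l * (cnj (u i) * a l i j * v j))"
    by (intro sum.cong[OF refl] sum.swap)
  also have "\<dots> = (\<Sum>l\<in>L. \<Sum>i<N. \<Sum>j<N. c l * (cnj (u i) * a l i j * v j))"
    by (rule sum.swap)
  finally show ?thesis unfolding sform_def by (simp add: sum_distrib_left)
qed

lemma sform_add: "sform N u (\<lambda>i j. a i j + b i j) v = sform N u a v + sform N u b v"
  unfolding sform_def by (simp add: algebra_simps sum.distrib)

lemma sform_split:
  "sform (m*d) u a v = (\<Sum>e<m. \<Sum>f<m. \<Sum>r<d. \<Sum>s<d. cnj (u (e*d+r)) * a (e*d+r) (f*d+s) * v (f*d+s))"
  unfolding sform_def sum_index_split by (intro sum.cong[OF refl] sum.swap)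

lemma amp_sum: "amp d (\<lambda>p q r s. \<Sum>l\<in>L. c l * t l p q r s) x i j = (\<Sum>l\<in>L. c l * amp d (t l) x i j)"
proof -
  have "amp d (\<lambda>p q r s. \<Sum>l\<in>L. c l * t l p q r s) x i j
     = (\<Sum>p<d. \<Sum>q<d. \<Sum>l\<in>L. c l * (x (i div d * d + p) (j div d * d + q) * t l p q (i mod d) (j mod d)))"
    unfolding amp_def by (simp add: sum_distrib_left mult_ac)
  also have "\<dots> = (\<Sum>p<d. \<Sum>l\<in>L. \<Sum>q<d. c l * (x (i div d * d + p) (j div d * d + q) * t l p q (i mod d) (j mod d)))"
    by (intro sum.cong[OF refl] sum.swap)
  also have "\<dots> = (\<Sum>l\<in>L. \<Sum>p<d. \<Sum>q<d. c l * (x (i div d * d + p) (j div d * d + q) * t l p q (i mod d) (j mod d)))"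
    by (rule sum.swap)
  finally show ?thesis unfolding amp_def by (simp add: sum_distrib_left)
qed

text \<open>The hypothesis describes the map x \<mapsto> C* x B, because entry (r,s) of C* E_pq B is
  \<open>cnj (C p r) * B q s\<close>. Its amplification multiplies by 1 \<otimes> C and 1 \<otimes>
  B, and these factors can be moved onto the vectors.\<close>

lemma sform_amp:
  assumes t: "\<And>p q r s. t p q r s = cnj (C p r) * B q s"
  shows "sform (m*d) u (amp d t x) v = sform (m*d) (lift d C u) x (lift d B v)"
proof -
  have "(\<Sum>r<d. \<Sum>s<d. cnj (u (e*d+r)) * amp d t x (e*d+r) (f*d+s) * v (f*d+s))
    = (\<Sum>p<d. \<Sum>q<d. cnj (lift d C u (e*d+p)) * x (e*d+p) (f*d+q) * lift d B v (f*d+q))"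
    (is "?l = ?r") for e f
  proof -
    have "?l = (\<Sum>r<d. \<Sum>s<d. \<Sum>p<d. \<Sum>q<d. cnj (u (e*d+r)) * cnj (C p r) * x (e*d+p) (f*d+q) * B q s * v (f*d+s))"
      by (intro sum.cong[OF refl])
         (simp add: amp_def t sum_distrib_left sum_distrib_right mult_ac)
    also have "\<dots> = (\<Sum>p<d. \<Sum>q<d. \<Sum>r<d. \<Sum>s<d. cnj (u (e*d+r)) * cnj (C p r) * x (e*d+p) (f*d+q) * B q s * v (f*d+s))"
      by (rule sum4_swap)
    also have "\<dots> = ?r"
      by (intro sum.cong[OF refl])
         (simp add: lift_def sum_distrib_left sum_distrib_right mult_ac)
    finally show ?thesis .
  qed
  then show ?thesis unfolding sform_split by simp
qed

lemma cb_boundI: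
  "(\<And>m x u v. m \<ge> 1 \<Longrightarrow> form_bound (m*d) x 1 \<Longrightarrow>
      cmod (sform (m*d) u (amp d t x) v) \<le> c * nrm (m*d) u * nrm (m*d) v) \<Longrightarrow> cb_bound d t c"
  by (auto simp: cb_bound_def form_bound_def)

lemma cb_boundD:
  "cb_bound d t c \<Longrightarrow> m \<ge> 1 \<Longrightarrow> form_bound (m*d) x 1 \<Longrightarrow> form_bound (m*d) (amp d t x) c"
  by (auto simp: cb_bound_def)

lemma amp_cong:
  assumes "\<And>p q r s. \<lbrakk>p < d; q < d; r < d; s < d\<rbrakk> \<Longrightarrow> t p q r s = t' p q r s" "d \<ge> 1"
  shows "amp d t x i j = amp d t' x i j"
  unfolding amp_def using assms by (intro sum.cong refl) auto

lemma cb_bound_cong: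
  assumes "\<And>p q r s. \<lbrakk>p < d; q < d; r < d; s < d\<rbrakk> \<Longrightarrow> t p q r s = t' p q r s" "d \<ge> 1"
  shows "cb_bound d t c = cb_bound d t' c"
  using amp_cong[OF assms] unfolding cb_bound_def by presburger

lemma cb_bound_add:
  assumes "cb_bound d t c" "cb_bound d t' c'"
  shows "cb_bound d (\<lambda>p q r s. t p q r s + t' p q r s) (c + c')"
proof (rule cb_boundI)
  fix m x u v assume m: "m \<ge> (1::nat)" "form_bound (m*d) x 1"
  have "amp d (\<lambda>p q r s. t p q r s + t' p q r s) x = (\<lambda>i j. amp d t x i j + amp d t' x i j)"
    unfolding amp_def by (simp add: algebra_simps sum.distrib)
  then have "sform (m*d) u (amp d (\<lambda>p q r s. t p q r s + t' p q r s) x) v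
      = sform (m*d) u (amp d t x) v + sform (m*d) u (amp d t' x) v"
    by (simp add: sform_add)
  moreover have "cmod (sform (m*d) u (amp d t x) v) \<le> c * nrm (m*d) u * nrm (m*d) v"
    "cmod (sform (m*d) u (amp d t' x) v) \<le> c' * nrm (m*d) u * nrm (m*d) v"
    using cb_boundD[OF assms(1) m] cb_boundD[OF assms(2) m] by (auto simp: form_bound_def)
  ultimately show "cmod (sform (m*d) u (amp d (\<lambda>p q r s. t p q r s + t' p q r s) x) v)
      \<le> (c + c') * nrm (m*d) u * nrm (m*d) v"
    by (smt (verit) norm_triangle_ineq distrib_right)
qed

text \<open>The matrix unit E_pr, applied blockwise, keeps at most one coordinate of each block and
  discards the rest.\<close>

lemma nrm_lift_unit_le:
  "nrm (m*d) (lift d (\<lambda>p' r'. if p' = p \<and> r' = r then 1 else 0) u) \<le> nrm (m*d) u"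
proof -
  let ?B = "\<lambda>p' r'. if p' = p \<and> r' = r then 1 else (0::complex)"
  have l: "lift d ?B u (a*d+p') = (if p' = p \<and> r < d then u (a*d+r) else 0)" if "p' < d" for a p'
  proof -
    have "lift d ?B u (a*d+p') = (\<Sum>r'<d. if r' = r then (if p' = p then u (a*d+r) else 0) else 0)"
      unfolding lift_def using that by (intro sum.cong refl) auto
    then show ?thesis by simp
  qed
  have "(\<Sum>p'<d. (cmod (lift d ?B u (a*d+p')))\<^sup>2) \<le> (\<Sum>p'<d. (cmod (u (a*d+p')))\<^sup>2)" for a
  proof -
    have "(\<Sum>p'<d. (cmod (lift d ?B u (a*d+p')))\<^sup>2)
       = (\<Sum>p'<d. if p' = p then (if r < d then (cmod (u (a*d+r)))\<^sup>2 else 0) else 0)"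
      by (intro sum.cong refl) (auto simp: l)
    also have "\<dots> \<le> (\<Sum>p'<d. (cmod (u (a*d+p')))\<^sup>2)"
      using member_le_sum[of r "{..<d}" "\<lambda>p'. (cmod (u (a*d+p')))\<^sup>2"]
      by (auto simp: sum_nonneg)
    finally show ?thesis .
  qed
  then have "(nrm (m*d) (lift d ?B u))\<^sup>2 \<le> (nrm (m*d) u)\<^sup>2"
    unfolding nrm_sq sum_index_split by (rule sum_mono)
  then show ?thesis by (rule power2_le_imp_le) simp
qed

text \<open>Every map is a combination of the d^4 maps x \<mapsto> E* x E' with matrix units E, E',
  each completely contractive, so the sum of the moduli of the coefficients is a bound. This makes
  the suprema in \<open>cb_norm\<close> finite.\<close>

lemma cb_bound_exists:
  assumes d: "d \<ge> 1"
  shows "\<exists>c\<ge>0. cb_bound d t c"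
proof -
  let ?L = "{..<d} \<times> {..<d} \<times> {..<d} \<times> {..<d}"
  define cf where "cf = (\<lambda>(p,q,r,s). t p q r s)"
  define e :: "nat \<Rightarrow> nat \<Rightarrow> nat \<Rightarrow> nat \<Rightarrow> complex"
    where "e p r = (\<lambda>p' r'. if p' = p \<and> r' = r then 1 else 0)" for p r
  define el where "el = (\<lambda>(p,q,r,s) p' q' r' s'. cnj (e p r p' r') * e q s q' s')"
  define c where "c = (\<Sum>l\<in>?L. cmod (cf l))"
  have el: "el l p' q' r' s' = (if l = (p',q',r',s') then 1 else 0)" for l p' q' r' s'
    by (auto simp: el_def e_def split: prod.splits)
  have "cb_bound d (\<lambda>p q r s. \<Sum>l\<in>?L. cf l * el l p q r s) c"
  proof (rule cb_boundI)
    fix m x u v assume "m \<ge> (1::nat)" and x: "form_bound (m*d) x 1"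
    have "cmod (sform (m*d) u (amp d (el l) x) v) \<le> nrm (m*d) u * nrm (m*d) v" for l
    proof -
      obtain p q r s where l: "l = (p,q,r,s)" by (cases l)
      have "sform (m*d) u (amp d (el l) x) v = sform (m*d) (lift d (e p r) u) x (lift d (e q s) v)"
        by (rule sform_amp) (simp add: el_def l)
      then have "cmod (sform (m*d) u (amp d (el l) x) v)
          \<le> nrm (m*d) (lift d (e p r) u) * nrm (m*d) (lift d (e q s) v)"
        using x unfolding form_bound_def by simp
      also have "\<dots> \<le> nrm (m*d) u * nrm (m*d) v"
        unfolding e_def by (intro mult_mono nrm_lift_unit_le) auto
      finally show ?thesis .
    qed
    then have "(\<Sum>l\<in>?L. cmod (cf l * sform (m*d) u (amp d (el l) x) v))
       \<le> (\<Sum>l\<in>?L. cmod (cf l) * (nrm (m*d) u * nrm (m*d) v))"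
      by (intro sum_mono) (simp add: norm_mult mult_left_mono)
    also have "\<dots> = c * nrm (m*d) u * nrm (m*d) v"
      unfolding c_def mult.assoc sum_distrib_right ..
    finally show "cmod (sform (m*d) u (amp d (\<lambda>p q r s. \<Sum>l\<in>?L. cf l * el l p q r s) x) v) \<le> c * nrm (m*d) u * nrm (m*d) v"
      unfolding amp_sum sform_sum by (rule order_trans[OF norm_sum])
  qed
  moreover have "(\<Sum>l\<in>?L. cf l * el l p q r s) = t p q r s" if "p<d" "q<d" "r<d" "s<d" for p q r s
  proof -
    have "(\<Sum>l\<in>?L. cf l * el l p q r s) = (\<Sum>l\<in>?L. if l = (p,q,r,s) then cf l else 0)"
      by (intro sum.cong refl) (simp add: el)
    also have "\<dots> = t p q r s" using that by (subst sum.delta) (auto simp: cf_def)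
    finally show ?thesis .
  qed
  ultimately have "cb_bound d t c"
    by (subst cb_bound_cong[OF _ d, symmetric, where t = "\<lambda>p q r s. \<Sum>l\<in>?L. cf l * el l p q r s"])
  moreover have "c \<ge> 0" by (simp add: c_def sum_nonneg)
  ultimately show ?thesis by blast
qed

text \<open>With G the sum of the lam_l B_l* B_l, this is the Gram identity for the vectors (1
  \<otimes> B_l) u: the weighted sum of their squared norms is the form of 1 \<otimes> G at u, read
  off block by block.\<close>

lemma nrm_lift_sq_sum:
  assumes G: "\<And>r s. G r s = (\<Sum>l\<in>L. complex_of_real (lam l) * (\<Sum>p<d. cnj (B l p r) * B l p s))"
  shows "complex_of_real (\<Sum>l\<in>L. lam l * (nrm (m*d) (lift d (B l) u))\<^sup>2)
    = (\<Sum>a<m. sform d (\<lambda>r. u (a*d+r)) G (\<lambda>r. u (a*d+r)))"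
proof -
  have 1: "complex_of_real ((cmod (lift d (B l) u (a*d+p)))\<^sup>2)
     = (\<Sum>r<d. \<Sum>s<d. cnj (u (a*d+r)) * (cnj (B l p r) * B l p s) * u (a*d+s))" if "p < d" for l a p
    using that unfolding complex_norm_square
    by (simp add: lift_def sum_distrib_left sum_distrib_right mult_ac)
  have 2: "complex_of_real ((nrm (m*d) (lift d (B l) u))\<^sup>2)
      = (\<Sum>a<m. sform d (\<lambda>r. u (a*d+r)) (\<lambda>r s. \<Sum>p<d. 1 * (cnj (B l p r) * B l p s)) (\<lambda>r. u (a*d+r)))" for l
    unfolding nrm_sq sum_index_split sform_sum by (simp add: 1 sform_def flip: of_real_power)
  have "complex_of_real (\<Sum>l\<in>L. lam l * (nrm (m*d) (lift d (B l) u))\<^sup>2)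
     = (\<Sum>l\<in>L. \<Sum>a<m. complex_of_real (lam l) * sform d (\<lambda>r. u (a*d+r)) (\<lambda>r s. \<Sum>p<d. 1 * (cnj (B l p r) * B l p s)) (\<lambda>r. u (a*d+r)))"
    unfolding of_real_sum of_real_mult 2 sum_distrib_left ..
  also have "\<dots> = (\<Sum>a<m. \<Sum>l\<in>L. complex_of_real (lam l) * sform d (\<lambda>r. u (a*d+r)) (\<lambda>r s. \<Sum>p<d. 1 * (cnj (B l p r) * B l p s)) (\<lambda>r. u (a*d+r)))"
    by (rule sum.swap)
  also have "\<dots> = (\<Sum>a<m. sform d (\<lambda>r. u (a*d+r)) G (\<lambda>r. u (a*d+r)))"
    unfolding sform_sum[symmetric] by (simp add: G[abs_def])
  finally show ?thesis .
qed

text \<open>A completely positive map attains its cb-norm at the identity.\<close>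

lemma cb_bound_cp:
  assumes lam: "\<And>l. l \<in> L \<Longrightarrow> lam l \<ge> 0"
    and G: "form_bound d (\<lambda>r s. \<Sum>l\<in>L. complex_of_real (lam l) * (\<Sum>p<d. cnj (B l p r) * B l p s)) \<delta>"
  shows "cb_bound d (\<lambda>p q r s. - (\<Sum>l\<in>L. complex_of_real (lam l) * (cnj (B l p r) * B l q s))) \<delta>"
proof (rule cb_boundI)
  let ?G = "\<lambda>r s. \<Sum>l\<in>L. complex_of_real (lam l) * (\<Sum>p<d. cnj (B l p r) * B l p s)"
  fix m x u v assume "m \<ge> (1::nat)" and x: "form_bound (m*d) x 1"
  define N where "N = m*d"
  have W: "(\<Sum>l\<in>L. lam l * (nrm N (lift d (B l) w))\<^sup>2) \<le> \<delta> * (nrm N w)\<^sup>2" for w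
  proof -
    have "(\<Sum>l\<in>L. lam l * (nrm N (lift d (B l) w))\<^sup>2) \<le> cmod (complex_of_real (\<Sum>l\<in>L. lam l * (nrm N (lift d (B l) w))\<^sup>2))"
      unfolding norm_of_real by (rule abs_ge_self)
    also have "\<dots> = cmod (\<Sum>a<m. sform d (\<lambda>r. w (a*d+r)) ?G (\<lambda>r. w (a*d+r)))"
      unfolding N_def by (subst nrm_lift_sq_sum[where G = ?G]) auto
    also have "\<dots> \<le> (\<Sum>a<m. cmod (sform d (\<lambda>r. w (a*d+r)) ?G (\<lambda>r. w (a*d+r))))"
      by (rule norm_sum)
    also have "\<dots> \<le> (\<Sum>a<m. \<delta> * (nrm d (\<lambda>r. w (a*d+r)))\<^sup>2)"
      using G unfolding form_bound_def power2_eq_square mult.assoc by (intro sum_mono) auto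
    also have "\<dots> = \<delta> * (nrm N w)\<^sup>2"
      unfolding N_def nrm_sq sum_index_split by (simp add: sum_distrib_left)
    finally show ?thesis .
  qed
  have W0: "0 \<le> (\<Sum>l\<in>L. lam l * (nrm N (lift d (B l) w))\<^sup>2)" for w
    by (intro sum_nonneg mult_nonneg_nonneg) (use lam in auto)
  have t: "(\<lambda>p q r s. - (\<Sum>l\<in>L. complex_of_real (lam l) * (cnj (B l p r) * B l q s)))
     = (\<lambda>p q r s. (\<Sum>l\<in>L. (- complex_of_real (lam l)) * (cnj (B l p r) * B l q s)))"
    by (simp add: sum_negf)
  have "cmod (sform N u (amp d (\<lambda>p q r s. - (\<Sum>l\<in>L. complex_of_real (lam l) * (cnj (B l p r) * B l q s))) x) v)
    = cmod (\<Sum>l\<in>L. (- complex_of_real (lam l)) * sform N (lift d (B l) u) x (lift d (B l) v))"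
    unfolding t amp_sum sform_sum N_def by (simp only: sform_amp[OF refl])
  also have "\<dots> \<le> (\<Sum>l\<in>L. cmod ((- complex_of_real (lam l)) * sform N (lift d (B l) u) x (lift d (B l) v)))"
    by (rule norm_sum)
  also have "\<dots> \<le> (\<Sum>l\<in>L. lam l * (nrm N (lift d (B l) u) * nrm N (lift d (B l) v)))"
    using x lam unfolding form_bound_def N_def
    by (intro sum_mono) (auto simp: norm_mult intro!: mult_left_mono)
  \<comment> \<open>Sharing each weight equally between both factors lets Cauchy-Schwarz over l
    separate u from v, so that \<open>W\<close> applies to each of them.\<close>
  also have "\<dots> = (\<Sum>l\<in>L. \<bar>sqrt (lam l) * nrm N (lift d (B l) u)\<bar> * \<bar>sqrt (lam l) * nrm N (lift d (B l) v)\<bar>)"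
    using lam by (intro sum.cong refl) (simp add: abs_mult mult_ac)
  also have "\<dots> \<le> L2_set (\<lambda>l. sqrt (lam l) * nrm N (lift d (B l) u)) L * L2_set (\<lambda>l. sqrt (lam l) * nrm N (lift d (B l) v)) L"
    by (rule L2_set_mult_ineq)
  also have "\<dots> = sqrt (\<Sum>l\<in>L. lam l * (nrm N (lift d (B l) u))\<^sup>2) * sqrt (\<Sum>l\<in>L. lam l * (nrm N (lift d (B l) v))\<^sup>2)"
    using lam unfolding L2_set_def by (simp add: power_mult_distrib)
  also have "\<dots> \<le> sqrt (\<delta> * (nrm N u)\<^sup>2) * sqrt (\<delta> * (nrm N v)\<^sup>2)"
    by (intro mult_mono real_sqrt_le_mono W real_sqrt_ge_zero W0 order_trans[OF W0 W])
  also have "\<dots> = \<bar>\<delta>\<bar> * (nrm N u * nrm N v)"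
  proof -
    have "sqrt (\<delta> * (nrm N u)\<^sup>2) * sqrt (\<delta> * (nrm N v)\<^sup>2) = sqrt ((\<delta> * (nrm N u * nrm N v))\<^sup>2)"
      unfolding real_sqrt_mult[symmetric] by (simp only: power2_eq_square mult_ac)
    then show ?thesis by (simp add: abs_mult)
  qed
  \<comment> \<open>The sign of \<delta> comes from \<open>W\<close>: a vector of nonzero norm
    forces \<delta> \<ge> 0, and for norm 0 both sides vanish.\<close>
  also have "\<dots> = \<delta> * nrm N u * nrm N v"
  proof (cases "nrm N u = 0")
    case False
    then have "\<delta> \<ge> 0" using order_trans[OF W0[of u] W[of u]]
      by (simp add: zero_le_mult_iff)
    then show ?thesis by simp
  qed simp
  finally show "cmod (sform (m*d) u (amp d (\<lambda>p q r s. - (\<Sum>l\<in>L. complex_of_real (lam l) * (cnj (B l p r) * B l q s))) x) v) \<le> \<delta> * nrm (m*d) u * nrm (m*d) v"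
    by (simp add: N_def)
qed

section \<open>The norms as bounds on forms\<close>

lemma Cauchy_Schwarz_nrm: "cmod (\<Sum>i<N. cnj (u i) * w i) \<le> nrm N u * nrm N w"
proof -
  have "cmod (\<Sum>i<N. cnj (u i) * w i) \<le> (\<Sum>i<N. \<bar>cmod (u i)\<bar> * \<bar>cmod (w i)\<bar>)"
    using norm_sum[of "\<lambda>i. cnj (u i) * w i" "{..<N}"] by (simp add: norm_mult)
  also have "\<dots> \<le> nrm N u * nrm N w"
    unfolding nrm_def by (rule L2_set_mult_ineq)
  finally show ?thesis .
qed

lemma nrm_scale: "nrm N (\<lambda>i. z * v i) = cmod z * nrm N v"
  unfolding nrm_def by (simp add: norm_mult L2_set_right_distrib)

lemma nrm_eq_0: "nrm N v = 0 \<Longrightarrow> i < N \<Longrightarrow> v i = 0"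
  unfolding nrm_def by (subst (asm) L2_set_eq_0_iff) auto

text \<open>For the forward direction the form is tested on u = a v, where its value is the squared
  norm of a v; the converse is Cauchy-Schwarz.\<close>

lemma form_bound_iff_nrm:
  assumes c: "c \<ge> 0"
  shows "form_bound N a c \<longleftrightarrow> (\<forall>v. nrm N (\<lambda>i. \<Sum>j<N. a i j * v j) \<le> c * nrm N v)"
proof
  have sf: "sform N u a v = (\<Sum>i<N. cnj (u i) * (\<Sum>j<N. a i j * v j))" for u v
    unfolding sform_def by (simp add: sum_distrib_left mult.assoc)
  { assume b: "form_bound N a c"
    show "\<forall>v. nrm N (\<lambda>i. \<Sum>j<N. a i j * v j) \<le> c * nrm N v"
    proof
      fix v
      define w where "w = (\<lambda>i. \<Sum>j<N. a i j * v j)"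
      have "sform N w a v = complex_of_real ((nrm N w)\<^sup>2)"
        unfolding sf nrm_sq of_real_sum complex_norm_square
        by (simp add: w_def mult.commute)
      then have "(nrm N w)\<^sup>2 = cmod (sform N w a v)" by (simp only: norm_of_real) simp
      also have "\<dots> \<le> c * nrm N w * nrm N v" using b by (simp add: form_bound_def)
      finally have "nrm N w * nrm N w \<le> nrm N w * (c * nrm N v)"
        by (simp add: power2_eq_square mult_ac)
      moreover have "nrm N w \<le> c * nrm N v" if "nrm N w = 0"
        using c that by simp
      ultimately show "nrm N (\<lambda>i. \<Sum>j<N. a i j * v j) \<le> c * nrm N v"
        unfolding w_def[symmetric]
        by (metis less_eq_real_def mult_le_cancel_left_pos nrm_nonneg)
    qed }
  assume b: "\<forall>v. nrm N (\<lambda>i. \<Sum>j<N. a i j * v j) \<le> c * nrm N v"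
  show "form_bound N a c"
    unfolding form_bound_def
  proof (intro allI)
    fix u v
    have "cmod (sform N u a v) \<le> nrm N u * nrm N (\<lambda>i. \<Sum>j<N. a i j * v j)"
      unfolding sf by (rule Cauchy_Schwarz_nrm)
    also have "\<dots> \<le> nrm N u * (c * nrm N v)"
      using b by (intro mult_left_mono) auto
    finally show "cmod (sform N u a v) \<le> c * nrm N u * nrm N v" by (simp add: mult_ac)
  qed
qed

lemma vnorm_nrm: "v \<in> carrier_vec N \<Longrightarrow> vnorm v = nrm N (\<lambda>i. v $ i)"
  by (simp add: vnorm_def nrm_def L2_set_def)

lemma mult_mat_vec_entry:
  "A \<in> carrier_mat N M \<Longrightarrow> v \<in> carrier_vec M \<Longrightarrow> i < N \<Longrightarrow> (A *\<^sub>v v) $ i = (\<Sum>j<M. A $$ (i,j) * v $ j)"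
  by (auto simp: scalar_prod_def lessThan_atLeast0)

lemma vnorm_mult_mat_vec:
  assumes "A \<in> carrier_mat N N" "v \<in> carrier_vec N"
  shows "vnorm (A *\<^sub>v v) = nrm N (\<lambda>i. \<Sum>j<N. A $$ (i,j) * v $ j)"
  using assms by (subst vnorm_nrm[of _ N]) (auto intro!: nrm_cong simp: mult_mat_vec_entry simp del: index_mult_mat_vec)

text \<open>The sum of the moduli of the entries bounds the set under the \<open>Sup\<close>, and
  the zero vector makes it nonempty; homogeneity passes from the unit ball to all vectors.\<close>

lemma opnorm_le_iff:
  assumes A: "A \<in> carrier_mat N N" and c: "c \<ge> 0"
  shows "opnorm A \<le> c \<longleftrightarrow> form_bound N (\<lambda>i j. A $$ (i,j)) c"
proof -
  let ?S = "{vnorm (A *\<^sub>v v) | v. v \<in> carrier_vec (dim_col A) \<and> vnorm v \<le> 1}"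
  have dc: "dim_col A = N" using A by auto
  have "vnorm (A *\<^sub>v v) \<le> (\<Sum>i<N. \<Sum>j<N. cmod (A $$ (i,j)))" if v: "v \<in> carrier_vec N" "vnorm v \<le> 1" for v
  proof -
    have "cmod (v $ j) \<le> 1" if "j < N" for j
      using member_le_L2_set[of "{..<N}" j "\<lambda>j. cmod (v $ j)"] that v
      by (simp add: vnorm_nrm nrm_def)
    then have le: "cmod (\<Sum>j<N. A $$ (i,j) * v $ j) \<le> (\<Sum>j<N. cmod (A $$ (i,j)))" for i
      by (intro sum_norm_le) (simp add: norm_mult mult_left_le)
    have "vnorm (A *\<^sub>v v) \<le> (\<Sum>i<N. cmod (\<Sum>j<N. A $$ (i,j) * v $ j))"
      unfolding vnorm_mult_mat_vec[OF A v(1)] nrm_def by (rule L2_set_le_sum) simp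
    also have "\<dots> \<le> (\<Sum>i<N. \<Sum>j<N. cmod (A $$ (i,j)))" by (intro sum_mono le)
    finally show ?thesis .
  qed
  then have bdd: "bdd_above ?S" by (intro bdd_aboveI) (auto simp: dc)
  have "vnorm (0\<^sub>v N) \<le> 1" by (simp add: vnorm_def)
  then have ne: "?S \<noteq> {}" using dc by (auto intro!: exI[of _ "0\<^sub>v N"])
  have 1: "opnorm A \<le> c \<longleftrightarrow> (\<forall>v. v \<in> carrier_vec N \<longrightarrow> vnorm v \<le> 1 \<longrightarrow> vnorm (A *\<^sub>v v) \<le> c)"
    unfolding opnorm_def cSup_le_iff[OF ne bdd] by (auto simp: dc)
  show ?thesis unfolding 1 form_bound_iff_nrm[OF c]
  proof safe
    fix v :: "complex vec"
    assume *: "\<forall>v. nrm N (\<lambda>i. \<Sum>j<N. A $$ (i, j) * v j) \<le> c * nrm N v" "v \<in> carrier_vec N" "vnorm v \<le> 1"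
    have "vnorm (A *\<^sub>v v) \<le> c * vnorm v"
      using * vnorm_mult_mat_vec[OF A *(2)] vnorm_nrm[OF *(2)] by auto
    also have "\<dots> \<le> c" using c *(3) by (simp add: mult_left_le)
    finally show "vnorm (A *\<^sub>v v) \<le> c" .
  next
    fix v :: "nat \<Rightarrow> complex"
    assume *: "\<forall>v. v \<in> carrier_vec N \<longrightarrow> vnorm v \<le> 1 \<longrightarrow> vnorm (A *\<^sub>v v) \<le> c"
    show "nrm N (\<lambda>i. \<Sum>j<N. A $$ (i, j) * v j) \<le> c * nrm N v"
    proof (cases "nrm N v = 0")
      case True
      then have "nrm N (\<lambda>i. \<Sum>j<N. A $$ (i, j) * v j) = nrm N (\<lambda>i. 0)"
        by (intro nrm_cong) (auto simp: nrm_eq_0 intro!: sum.neutral)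
      then show ?thesis using True by (simp add: nrm_def L2_set_def)
    next
      case False
      define s where "s = nrm N v"
      have s: "s > 0" using False nrm_nonneg[of N v] unfolding s_def by linarith
      let ?z = "complex_of_real (inverse s)"
      let ?w = "vec N (\<lambda>i. ?z * v i)"
      have w: "?w \<in> carrier_vec N" by simp
      have "vnorm ?w = nrm N (\<lambda>i. ?z * v i)"
        unfolding vnorm_nrm[OF w] by (rule nrm_cong) simp
      also have "\<dots> = 1" using s by (simp only: nrm_scale) (simp add: s_def[symmetric] norm_inverse)
      finally have "vnorm (A *\<^sub>v ?w) \<le> c" using * by simp
      moreover have "vnorm (A *\<^sub>v ?w) = nrm N (\<lambda>i. ?z * (\<Sum>j<N. A $$ (i, j) * v j))"
        unfolding vnorm_mult_mat_vec[OF A w]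
        by (rule nrm_cong) (simp add: sum_distrib_left mult_ac)
      ultimately have "inverse s * nrm N (\<lambda>i. \<Sum>j<N. A $$ (i, j) * v j) \<le> c"
        using s by (simp add: nrm_scale norm_inverse)
      then show ?thesis using s by (simp add: s_def[symmetric] field_simps)
    qed
  qed
qed

abbreviation mapcoeff :: "nat \<Rightarrow> (complex mat \<Rightarrow> complex mat) \<Rightarrow> nat \<Rightarrow> nat \<Rightarrow> nat \<Rightarrow> nat \<Rightarrow> complex" where
  "mapcoeff d T \<equiv> (\<lambda>p q r s. T (munit d p q) $$ (r,s))"

text \<open>Images of matrix units of the right size are what make the entries of
  \<open>kron\<close>, and so of \<open>tensor_map\<close>, computable by \<open>div\<close> and
  \<open>mod\<close>. The property holds for every \<open>tensor_map\<close> and hence passes to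
  tensor powers.\<close>

definition closed_map :: "nat \<Rightarrow> (complex mat \<Rightarrow> complex mat) \<Rightarrow> bool" where
  "closed_map d T \<longleftrightarrow> (\<forall>p<d. \<forall>q<d. T (munit d p q) \<in> carrier_mat d d)"

lemma tensor_map_entry:
  assumes "closed_map n T" "closed_map k S" "r < n*k" "c < n*k"
  shows "tensor_map n k T S x $$ (r,c) = (\<Sum>i<n. \<Sum>j<n. \<Sum>p<k. \<Sum>q<k. x $$ (i*k+p, j*k+q) *
     (mapcoeff n T i j (r div k) (c div k) * mapcoeff k S p q (r mod k) (c mod k)))"
proof -
  have "kron (T (munit n i j)) (S (munit k p q)) $$ (r,c)
      = mapcoeff n T i j (r div k) (c div k) * mapcoeff k S p q (r mod k) (c mod k)"
    if "i < n" "j < n" "p < k" "q < k" for i j p q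
  proof -
    have "T (munit n i j) \<in> carrier_mat n n" "S (munit k p q) \<in> carrier_mat k k"
      using assms(1,2) that by (auto simp: closed_map_def)
    then have "dim_row (T (munit n i j)) = n" "dim_col (T (munit n i j)) = n"
      "dim_row (S (munit k p q)) = k" "dim_col (S (munit k p q)) = k" by auto
    then show ?thesis using assms(3,4) by (simp add: kron_def)
  qed
  then show ?thesis using assms(3,4) by (simp add: tensor_map_def)
qed

lemma closed_map_tensor_map: "closed_map (n*k) (tensor_map n k T S)"
  by (simp add: closed_map_def tensor_map_def)

lemma closed_map_id: "closed_map m (\<lambda>x. x)"
  by (simp add: closed_map_def munit_def)

lemma tensor_map_id_entry:
  assumes T: "closed_map d T" and ij: "i < m*d" "j < m*d"
  shows "tensor_map m d (\<lambda>x. x) T X $$ (i,j) = amp d (mapcoeff d T) (\<lambda>i j. X $$ (i,j)) i j"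
proof -
  have dm: "i div d < m" "j div d < m"
    using ij by (auto simp: less_mult_imp_div_less)
  have "tensor_map m d (\<lambda>x. x) T X $$ (i,j)
    = (\<Sum>a<m. \<Sum>b<m. if b = j div d then if a = i div d then amp d (mapcoeff d T) (\<lambda>i j. X $$ (i,j)) i j else 0 else 0)"
    unfolding tensor_map_entry[OF closed_map_id T ij] amp_def
    by (intro sum.cong refl) (use dm in \<open>auto simp: munit_def\<close>)
  also have "\<dots> = amp d (mapcoeff d T) (\<lambda>i j. X $$ (i,j)) i j"
    using dm by (simp add: sum.delta)
  finally show ?thesis .
qed

lemma opnorm_nonneg:
  assumes "A \<in> carrier_mat N N" shows "opnorm A \<ge> 0"
proof (rule ccontr)
  assume "\<not> ?thesis"
  then have neg: "opnorm A < 0" by simp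
  then have "form_bound N (\<lambda>i j. A $$ (i,j)) 0" using opnorm_le_iff[OF assms, of 0] by simp
  let ?S = "{vnorm (A *\<^sub>v v) | v. v \<in> carrier_vec (dim_col A) \<and> vnorm v \<le> 1}"
  have b: "vnorm (A *\<^sub>v v) \<le> 0" if "v \<in> carrier_vec N" for v
    using \<open>form_bound N _ 0\<close> that unfolding form_bound_iff_nrm[OF order_refl] by (simp add: vnorm_mult_mat_vec[OF assms])
  have "vnorm (A *\<^sub>v 0\<^sub>v N) \<le> opnorm A"
    unfolding opnorm_def using assms b
    by (intro cSup_upper bdd_aboveI[of _ 0]) (auto intro!: exI[of _ "0\<^sub>v N"] simp: vnorm_def)
  moreover have "vnorm (A *\<^sub>v 0\<^sub>v N) \<ge> 0" by (simp add: vnorm_def sum_nonneg)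
  ultimately show False using neg by simp
qed

text \<open>Three nested suprema, over vectors, contractions and amplifications, are unfolded one
  after the other. A single constant from \<open>cb_bound_exists\<close> bounds the outer two
  levels, and the zero matrix makes the middle set nonempty.\<close>

lemma cb_norm_le_iff:
  assumes T: "closed_map d T" and d: "d \<ge> 1" and c: "c \<ge> 0"
  shows "cb_norm d T \<le> c \<longleftrightarrow> cb_bound d (mapcoeff d T) c"
proof -
  let ?A = "\<lambda>m X. tensor_map m d (\<lambda>x. x) T X"
  let ?S = "\<lambda>m. {opnorm (?A m X) | X. X \<in> carrier_mat (m*d) (m*d) \<and> opnorm X \<le> 1}"
  let ?M = "{map_norm (m*d) (?A m) | m. m \<ge> 1}"
  have car: "?A m X \<in> carrier_mat (m*d) (m*d)" for m X by (simp add: tensor_map_def)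
  have A: "opnorm (?A m X) \<le> c' \<longleftrightarrow> form_bound (m*d) (amp d (mapcoeff d T) (\<lambda>i j. X $$ (i,j))) c'"
    if "c' \<ge> 0" for m X c'
    unfolding opnorm_le_iff[OF car that] by (rule form_bound_cong) (rule tensor_map_id_entry[OF T])
  obtain C where C: "C \<ge> 0" "cb_bound d (mapcoeff d T) C" using cb_bound_exists[OF d] by blast
  have bS: "opnorm (?A m X) \<le> C" if "m \<ge> 1" "X \<in> carrier_mat (m*d) (m*d)" "opnorm X \<le> 1" for m X
    using that C cb_boundD[OF C(2)] by (simp add: A opnorm_le_iff)
  have S_bdd: "bdd_above (?S m)" if "m \<ge> 1" for m using bS[OF that] by (intro bdd_aboveI) auto
  have "opnorm (0\<^sub>m N N) \<le> 1" for N
    by (subst opnorm_le_iff[of _ N]) (auto simp: form_bound_def sform_def)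
  then have S_ne: "?S m \<noteq> {}" for m by (auto intro!: exI[of _ "0\<^sub>m (m*d) (m*d)"])
  have map_le: "map_norm (m*d) (?A m) \<le> c' \<longleftrightarrow>
      (\<forall>X. X \<in> carrier_mat (m*d) (m*d) \<longrightarrow> opnorm X \<le> 1 \<longrightarrow> opnorm (?A m X) \<le> c')" if "m \<ge> 1" for m c'
    unfolding map_norm_def cSup_le_iff[OF S_ne S_bdd[OF that]] by blast
  have M_bdd: "bdd_above ?M"
    using map_le bS by (intro bdd_aboveI[of _ C]) auto
  have M_ne: "?M \<noteq> {}" by auto
  have "cb_norm d T \<le> c \<longleftrightarrow> (\<forall>m\<ge>1. map_norm (m*d) (?A m) \<le> c)"
    unfolding cb_norm_def cSup_le_iff[OF M_ne M_bdd] by blast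
  also have "\<dots> \<longleftrightarrow> (\<forall>m\<ge>1. \<forall>X. X \<in> carrier_mat (m*d) (m*d) \<longrightarrow> opnorm X \<le> 1 \<longrightarrow> opnorm (?A m X) \<le> c)"
    using map_le by simp
  also have "\<dots> \<longleftrightarrow> cb_bound d (mapcoeff d T) c"
  proof
    assume "cb_bound d (mapcoeff d T) c"
    then show "\<forall>m\<ge>1. \<forall>X. X \<in> carrier_mat (m*d) (m*d) \<longrightarrow> opnorm X \<le> 1 \<longrightarrow> opnorm (?A m X) \<le> c"
      using cb_boundD c by (simp add: A opnorm_le_iff)
  next
    assume *: "\<forall>m\<ge>1. \<forall>X. X \<in> carrier_mat (m*d) (m*d) \<longrightarrow> opnorm X \<le> 1 \<longrightarrow> opnorm (?A m X) \<le> c"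
    show "cb_bound d (mapcoeff d T) c"
      unfolding cb_bound_def
    proof (intro allI impI)
      fix m x assume m: "m \<ge> (1::nat)" and x: "form_bound (m*d) x 1"
      \<comment> \<open>\<open>cb_bound\<close> ranges over functions and \<open>cb_norm\<close>
        over matrices; truncating \<open>x\<close> is harmless because \<open>amp\<close> reads only
        indices below m*d.\<close>
      define X where "X = mat (m*d) (m*d) (\<lambda>(i,j). x i j)"
      have X: "X \<in> carrier_mat (m*d) (m*d)" by (simp add: X_def)
      have "form_bound (m*d) (\<lambda>i j. X $$ (i,j)) 1"
        using x by (subst form_bound_cong[where a' = x]) (auto simp: X_def)
      then have "form_bound (m*d) (amp d (mapcoeff d T) (\<lambda>i j. X $$ (i,j))) c"
        using * m X c by (simp add: A opnorm_le_iff)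
      moreover have "amp d (mapcoeff d T) (\<lambda>i j. X $$ (i,j)) i j = amp d (mapcoeff d T) x i j"
        if "i < m*d" "j < m*d" for i j
      proof -
        have lt: "i div d * d + p < m*d" if "i < m*d" "p < d" for i p
        proof -
          have "i div d < m" using that by (simp add: less_mult_imp_div_less)
          then have "Suc (i div d) * d \<le> m * d" by (intro mult_le_mono1) simp
          then show ?thesis using that by simp
        qed
        show ?thesis unfolding amp_def using that by (intro sum.cong refl) (auto simp: X_def lt)
      qed
      ultimately show "form_bound (m*d) (amp d (mapcoeff d T) x) c"
        using form_bound_cong by blast
    qed
  qed
  finally show ?thesis .
qed

text \<open>A negative norm would give the bound 0 by \<open>cb_norm_le_iff\<close>. Then all inner
  suprema are suprema of {0}, so the norm would be 0. Nonnegativity is what bounds the infimum in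
  \<open>d_cb\<close> from below.\<close>

lemma cb_norm_nonneg:
  assumes T: "closed_map d T" and d: "d \<ge> 1"
  shows "cb_norm d T \<ge> 0"
proof (rule ccontr)
  assume neg: "\<not> ?thesis"
  let ?A = "\<lambda>m X. tensor_map m d (\<lambda>x. x) T X"
  let ?S = "\<lambda>m. {opnorm (?A m X) | X. X \<in> carrier_mat (m*d) (m*d) \<and> opnorm X \<le> 1}"
  have b: "cb_bound d (mapcoeff d T) 0" using cb_norm_le_iff[OF T d, of 0] neg by simp
  have car: "?A m X \<in> carrier_mat (m*d) (m*d)" for m X by (simp add: tensor_map_def)
  have 0: "opnorm (?A m X) = 0" if "m \<ge> 1" "X \<in> carrier_mat (m*d) (m*d)" "opnorm X \<le> 1" for m X
  proof -
    have "form_bound (m*d) (amp d (mapcoeff d T) (\<lambda>i j. X $$ (i,j))) 0"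
      using that cb_boundD[OF b] by (simp add: opnorm_le_iff)
    then have "form_bound (m*d) (\<lambda>i j. ?A m X $$ (i,j)) 0"
      by (subst form_bound_cong) (auto simp: tensor_map_id_entry[OF T])
    then show ?thesis using opnorm_nonneg[OF car] opnorm_le_iff[OF car, of 0] by (simp add: order_antisym)
  qed
  have "opnorm (0\<^sub>m N N) \<le> 1" for N
    by (subst opnorm_le_iff[of _ N]) (auto simp: form_bound_def sform_def)
  then have "?S m = {0}" if "m \<ge> 1" for m
    using 0[OF that] by (auto intro!: exI[of _ "0\<^sub>m (m*d) (m*d)"])
  then have z: "map_norm (m*d) (?A m) = 0" if "m \<ge> 1" for m
    using that unfolding map_norm_def by simp
  have "{f m | m. m \<ge> 1} = {0}" if "\<And>m. m \<ge> 1 \<Longrightarrow> f m = 0" for f :: "nat \<Rightarrow> real"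
    using that by force
  from this[of "\<lambda>m. map_norm (m*d) (?A m)", OF z]
  have "{map_norm (m*d) (?A m) | m. m \<ge> 1} = {0}" .
  then show False using neg unfolding cb_norm_def by simp
qed

lemma cb_bound_cb_norm:
  assumes "closed_map d T" "d \<ge> 1"
  shows "cb_bound d (mapcoeff d T) (cb_norm d T)"
  using cb_norm_le_iff[OF assms cb_norm_nonneg[OF assms]] by simp

section \<open>Compression to a corner\<close>

text \<open>The vector V u = u \<otimes> e_0, since index i*k + r stands for the pair (i,r).\<close>

definition spread :: "nat \<Rightarrow> (nat \<Rightarrow> complex) \<Rightarrow> nat \<Rightarrow> complex" where
  "spread k u i = (if i mod k = 0 then u (i div k) else 0)"

text \<open>The matrix x \<otimes> E_00, that is, x conjugated by the isometry V. In the other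
  direction, sampling z at the indices i*k and j*k gives the compression of z by V.\<close>

definition spread2 :: "nat \<Rightarrow> (nat \<Rightarrow> nat \<Rightarrow> complex) \<Rightarrow> nat \<Rightarrow> nat \<Rightarrow> complex" where
  "spread2 k x i j = (if i mod k = 0 \<and> j mod k = 0 then x (i div k) (j div k) else 0)"

lemma sum_only_0: "k \<ge> 1 \<Longrightarrow> (\<And>r. r < k \<Longrightarrow> r \<noteq> 0 \<Longrightarrow> f r = 0) \<Longrightarrow> (\<Sum>r<k. f r) = f (0::nat)"
  for f :: "nat \<Rightarrow> 'a::comm_monoid_add"
  by (subst sum.remove[of _ 0]) (auto intro!: sum.neutral)

lemma nrm_spread: "k \<ge> 1 \<Longrightarrow> nrm (M*k) (spread k u) = nrm M u"
proof -
  assume k: "k \<ge> 1"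
  have "(nrm (M*k) (spread k u))\<^sup>2 = (nrm M u)\<^sup>2"
    unfolding nrm_sq sum_index_split using k
    by (intro sum.cong refl) (subst sum_only_0, auto simp: spread_def)
  then show ?thesis by simp
qed

lemma nrm_subsample: "k \<ge> 1 \<Longrightarrow> nrm M (\<lambda>i. u (i*k)) \<le> nrm (M*k) u"
proof -
  assume k: "k \<ge> 1"
  have "(cmod (u (a*k)))\<^sup>2 \<le> (\<Sum>r<k. (cmod (u (a*k+r)))\<^sup>2)" for a
    using member_le_sum[of 0 "{..<k}" "\<lambda>r. (cmod (u (a*k+r)))\<^sup>2"] k by simp
  then have "(nrm M (\<lambda>i. u (i*k)))\<^sup>2 \<le> (nrm (M*k) u)\<^sup>2"
    unfolding nrm_sq sum_index_split by (rule sum_mono)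
  then show ?thesis by (rule power2_le_imp_le) simp
qed

lemma sform_spread2:
  assumes k: "k \<ge> 1"
  shows "sform (M*k) u (spread2 k x) v = sform M (\<lambda>i. u (i*k)) x (\<lambda>i. v (i*k))"
  unfolding sform_split unfolding sform_def
  apply (intro sum.cong refl)
  apply (subst sum_only_0[OF k])
   apply (simp add: spread2_def)
  apply (subst sum_only_0[OF k])
  using k by (simp_all add: spread2_def)

lemma sform_spread:
  assumes k: "k \<ge> 1"
  shows "sform (M*k) (spread k u) z (spread k v) = sform M u (\<lambda>i j. z (i*k) (j*k)) v"
  unfolding sform_split unfolding sform_def
  apply (intro sum.cong refl)
  apply (subst sum_only_0[OF k])
   apply (simp add: spread_def)
  apply (subst sum_only_0[OF k])
  using k by (simp_all add: spread_def)

lemma form_bound_spread2: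
  assumes "k \<ge> 1" "form_bound M x c" "c \<ge> 0"
  shows "form_bound (M*k) (spread2 k x) c"
  unfolding form_bound_def
proof (intro allI)
  fix u v
  have "cmod (sform (M*k) u (spread2 k x) v) \<le> c * (nrm M (\<lambda>i. u (i*k)) * nrm M (\<lambda>i. v (i*k)))"
    using assms(2) unfolding sform_spread2[OF assms(1)] form_bound_def by (simp add: mult.assoc)
  also have "\<dots> \<le> c * (nrm (M*k) u * nrm (M*k) v)"
    using assms by (intro mult_left_mono mult_mono nrm_subsample) auto
  finally show "cmod (sform (M*k) u (spread2 k x) v) \<le> c * nrm (M*k) u * nrm (M*k) v"
    by (simp add: mult.assoc)
qed

lemma form_bound_subsample:
  assumes "k \<ge> 1" "form_bound (M*k) z c"
  shows "form_bound M (\<lambda>i j. z (i*k) (j*k)) c"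
  unfolding form_bound_def
proof (intro allI)
  fix u v
  show "cmod (sform M u (\<lambda>i j. z (i*k) (j*k)) v) \<le> c * nrm M u * nrm M v"
    using assms(2) unfolding form_bound_def sform_spread[OF assms(1), symmetric]
    by (metis nrm_spread[OF assms(1)])
qed

text \<open>The new family encodes the compression by V of the value of \<tau> at x \<otimes> E_00.
  Padding and sampling both preserve form bounds, and (m*n)*k = m*(n*k) lets the same two operations
  serve at every amplification.\<close>

lemma cb_bound_compress:
  assumes \<tau>: "cb_bound (n*k) \<tau> c" and k: "k \<ge> 1" and n: "n \<ge> 1"
  shows "cb_bound n (\<lambda>p q r s. \<tau> (p*k) (q*k) (r*k) (s*k)) c"
  unfolding cb_bound_def
proof (intro allI impI)
  fix m x assume m: "m \<ge> (1::nat)" and x: "form_bound (m*n) x 1"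
  let ?t = "\<lambda>p q r s. \<tau> (p*k) (q*k) (r*k) (s*k)"
  have "form_bound (m*(n*k)) (amp (n*k) \<tau> (spread2 k x)) c"
    using form_bound_spread2[OF k x] by (intro cb_boundD[OF \<tau> m]) (simp add: mult.assoc)
  then have "form_bound (m*n) (\<lambda>i j. amp (n*k) \<tau> (spread2 k x) (i*k) (j*k)) c"
    by (intro form_bound_subsample[OF k]) (simp add: mult.assoc)
  moreover have "amp (n*k) \<tau> (spread2 k x) (i*k) (j*k) = amp n ?t x i j" for i j
  proof -
    \<comment> \<open>The same index, read as (a,(p,p')) for the amplification over
      \<open>n*k\<close> and as ((a,p),p') for the padding.\<close>
    have ix: "a * (n*k) + (p*k + p') = (a*n+p)*k + p'" for a p p' by (simp add: algebra_simps)
    have "amp (n*k) \<tau> (spread2 k x) (i*k) (j*k)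
      = (\<Sum>p<n. \<Sum>p'<k. \<Sum>q<n. \<Sum>q'<k. spread2 k x ((i div n * n + p)*k + p') ((j div n * n + q)*k + q')
          * \<tau> (p*k+p') (q*k+q') ((i mod n)*k) ((j mod n)*k))"
      unfolding amp_def sum_index_split using k by (simp add: ix mult_mod_left[symmetric])
    also have "\<dots> = (\<Sum>p<n. \<Sum>q<n. x (i div n * n + p) (j div n * n + q) * ?t p q (i mod n) (j mod n))"
      apply (rule sum.cong[OF refl])
      apply (subst sum_only_0[OF k])
       apply (simp add: spread2_def)
      apply (subst sum_only_0[OF k])
      using k by (simp_all add: spread2_def)
    finally show ?thesis by (simp add: amp_def)
  qed
  ultimately show "form_bound (m*n) (amp n ?t x) c" by simp
qed

section \<open>Unitary matrices and the singular value decomposition\<close>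

lemma mult_mat_entry:
  "A \<in> carrier_mat n m \<Longrightarrow> B \<in> carrier_mat m l \<Longrightarrow> i < n \<Longrightarrow> j < l \<Longrightarrow>
    (A * B) $$ (i,j) = (\<Sum>k<m. A $$ (i,k) * B $$ (k,j))"
  by (auto simp: scalar_prod_def lessThan_atLeast0 intro!: sum.cong)

lemma ctrans_carrier [simp]: "A \<in> carrier_mat n m \<Longrightarrow> ctrans A \<in> carrier_mat m n"
  by (auto simp: ctrans_def)

lemma ctrans_entry: "A \<in> carrier_mat n m \<Longrightarrow> i < m \<Longrightarrow> j < n \<Longrightarrow> ctrans A $$ (i,j) = cnj (A $$ (j,i))"
  by (auto simp: ctrans_def)

lemma ctrans_ctrans: "ctrans (ctrans A) = A"
  by (rule eq_matI) (auto simp: ctrans_def)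

lemma ctrans_mult:
  assumes "A \<in> carrier_mat n m" "B \<in> carrier_mat m l"
  shows "ctrans (A * B) = ctrans B * ctrans A"
proof (rule eq_matI)
  fix i j assume "i < dim_row (ctrans B * ctrans A)" "j < dim_col (ctrans B * ctrans A)"
  then have ij: "i < l" "j < n" using assms by (auto simp: ctrans_def)
  show "ctrans (A * B) $$ (i,j) = (ctrans B * ctrans A) $$ (i,j)"
    using assms ij
    by (simp add: ctrans_entry[of _ n l] ctrans_entry[of _ n m] ctrans_entry[of _ m l]
        mult_mat_entry[of _ n m _ l] mult_mat_entry[of _ l m _ n] mult.commute
        del: index_mult_mat)
qed (use assms in \<open>auto simp: ctrans_def\<close>)

lemma unitary_carrier: "unitary_mat n U \<Longrightarrow> U \<in> carrier_mat n n"
  by (simp add: unitary_mat_def)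

lemma unitary_ctrans: "unitary_mat n U \<Longrightarrow> unitary_mat n (ctrans U)"
  by (simp add: unitary_mat_def ctrans_ctrans)

text \<open>Orthonormal columns say that the adjoint is a left inverse; for square matrices it is
  then a right inverse as well.\<close>

lemma unitary_iff_orthonormal:
  assumes U: "U \<in> carrier_mat n n"
  shows "unitary_mat n U \<longleftrightarrow>
    (\<forall>i<n. \<forall>j<n. (\<Sum>p<n. cnj (U $$ (p,i)) * U $$ (p,j)) = (if i = j then 1 else 0))"
proof -
  have e: "(ctrans U * U) $$ (i,j) = (\<Sum>p<n. cnj (U $$ (p,i)) * U $$ (p,j))" if "i < n" "j < n" for i j
    using that U by (simp add: mult_mat_entry[of _ n n _ n] ctrans_entry del: index_mult_mat)
  have "unitary_mat n U \<longleftrightarrow> ctrans U * U = 1\<^sub>m n"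
    using U mat_mult_left_right_inverse[OF ctrans_carrier[OF U] U] by (auto simp: unitary_mat_def)
  also have "\<dots> \<longleftrightarrow> (\<forall>i<n. \<forall>j<n. (ctrans U * U) $$ (i,j) = 1\<^sub>m n $$ (i,j))"
    using U by (auto simp: mat_eq_iff ctrans_def)
  finally show ?thesis by (simp add: e del: index_mult_mat)
qed

lemma unitary_orthonormal:
  "unitary_mat n U \<Longrightarrow> i < n \<Longrightarrow> j < n \<Longrightarrow> (\<Sum>p<n. cnj (U $$ (p,i)) * U $$ (p,j)) = (if i = j then 1 else 0)"
  using unitary_iff_orthonormal[OF unitary_carrier] by blast

lemma unitary_mult:
  assumes "unitary_mat n U" "unitary_mat n V"
  shows "unitary_mat n (U * V)"
proof -
  note c = unitary_carrier[OF assms(1)] unitary_carrier[OF assms(2)]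
  note cc = c[THEN ctrans_carrier]
  have "ctrans (U * V) * (U * V) = ctrans V * (ctrans U * U) * V"
    using c cc by (simp add: ctrans_mult[of _ n n _ n] assoc_mult_mat[of _ n n _ n _ n] mult_carrier_mat[of _ n n _ n])
  also have "\<dots> = 1\<^sub>m n" using assms c cc
    by (simp add: unitary_mat_def right_mult_one_mat[of _ n n])
  finally have 1: "ctrans (U * V) * (U * V) = 1\<^sub>m n" .
  have "(U * V) * ctrans (U * V) = U * (V * ctrans V) * ctrans U"
    using c cc by (simp add: ctrans_mult[of _ n n _ n] assoc_mult_mat[of _ n n _ n _ n] mult_carrier_mat[of _ n n _ n])
  also have "\<dots> = 1\<^sub>m n" using assms c cc
    by (simp add: unitary_mat_def right_mult_one_mat[of _ n n])
  finally show ?thesis using 1 c by (simp add: unitary_mat_def)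
qed

lemma unitary_one: "unitary_mat n (1\<^sub>m n)"
proof -
  have "ctrans (1\<^sub>m n) = 1\<^sub>m n" by (rule eq_matI) (auto simp: ctrans_def)
  then show ?thesis by (simp add: unitary_mat_def)
qed

lemma unitary_column_nrm: "unitary_mat n U \<Longrightarrow> i < n \<Longrightarrow> nrm n (\<lambda>p. U $$ (p,i)) = 1"
proof -
  assume U: "unitary_mat n U" "i < n"
  have "complex_of_real ((nrm n (\<lambda>p. U $$ (p,i)))\<^sup>2) = 1"
    unfolding nrm_sq of_real_sum complex_norm_square
    using unitary_orthonormal[OF U(1) U(2) U(2)] by (simp add: mult.commute)
  then have "(nrm n (\<lambda>p. U $$ (p,i)))\<^sup>2 = 1" by (metis of_real_eq_1_iff)
  then show ?thesis using nrm_nonneg[of n "\<lambda>p. U $$ (p,i)"] by (simp add: power2_eq_1_iff)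
qed

lemma unitary_entry_le: "unitary_mat n U \<Longrightarrow> i < n \<Longrightarrow> j < n \<Longrightarrow> cmod (U $$ (i,j)) \<le> 1"
  using unitary_column_nrm[of n U j] member_le_L2_set[of "{..<n}" i "\<lambda>i. cmod (U $$ (i,j))"]
  by (simp add: nrm_def)

lemma unitary_form_bound:
  assumes U: "unitary_mat n U"
  shows "form_bound n (\<lambda>i j. U $$ (i,j)) 1"
proof -
  have "nrm n (\<lambda>i. \<Sum>j<n. U $$ (i,j) * v j) = nrm n v" for v
  proof -
    \<comment> \<open>A one-element mixture with m = 1 in \<open>nrm_lift_sq_sum\<close>: its Gram
      matrix is the product of the adjoint of U with U, the identity.\<close>
    define G where "G = (\<lambda>r s. \<Sum>l\<in>{0::nat}. complex_of_real 1 * (\<Sum>p<n. cnj (U $$ (p,r)) * U $$ (p,s)))"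
    have "nrm (1*n) (lift n (\<lambda>i j. U $$ (i,j)) v) = nrm n (\<lambda>i. \<Sum>j<n. U $$ (i,j) * v j)"
      by (simp, rule nrm_cong) (simp add: lift_def)
    then have "complex_of_real ((nrm n (\<lambda>i. \<Sum>j<n. U $$ (i,j) * v j))\<^sup>2) = sform n v G v"
      using nrm_lift_sq_sum[where G = G and L = "{0::nat}" and lam = "\<lambda>_. 1" and d = n
          and B = "\<lambda>_ i j. U $$ (i,j)" and m = 1 and u = v]
      by (simp add: G_def)
    also have "\<dots> = sform n v (\<lambda>i j. if i = j then 1 else 0) v"
      by (rule sform_cong) (auto simp: G_def unitary_orthonormal[OF U])
    also have "\<dots> = (\<Sum>i<n. \<Sum>j<n. if j = i then cnj (v i) * v i else 0)"
      unfolding sform_def by (intro sum.cong refl) auto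
    also have "\<dots> = complex_of_real ((nrm n v)\<^sup>2)"
      unfolding nrm_sq of_real_sum complex_norm_square by (simp add: mult.commute)
    finally have "(nrm n (\<lambda>i. \<Sum>j<n. U $$ (i,j) * v j))\<^sup>2 = (nrm n v)\<^sup>2"
      unfolding of_real_eq_iff .
    then show ?thesis by simp
  qed
  then show ?thesis by (simp add: form_bound_iff_nrm)
qed

section \<open>Compactness of the unitary group\<close>

lemma bounded_complex_subseq:
  fixes f :: "nat \<Rightarrow> complex"
  assumes "\<And>j. cmod (f j) \<le> C"
  shows "\<exists>r g. strict_mono r \<and> (\<lambda>j. f (r j)) \<longlonglongrightarrow> g"
proof -
  have R: "\<exists>r. strict_mono r \<and> convergent (\<lambda>j. x (r j))" if "\<And>j. \<bar>x j\<bar> \<le> C" for x :: "nat \<Rightarrow> real"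
  proof -
    obtain r where r: "strict_mono r" "monoseq (\<lambda>j. x (r j))" using seq_monosub[of x] by blast
    have "Bseq (\<lambda>j. x (r j))" using that by (intro BseqI'[of _ C]) simp
    then show ?thesis using r Bseq_monoseq_convergent by blast
  qed
  have "\<And>j. \<bar>Re (f j)\<bar> \<le> C" using assms abs_Re_le_cmod order_trans by blast
  then obtain r where r: "strict_mono r" "convergent (\<lambda>j. Re (f (r j)))" using R[of "\<lambda>j. Re (f j)"] by blast
  have "\<And>j. \<bar>Im (f (r j))\<bar> \<le> C" using assms abs_Im_le_cmod order_trans by blast
  then obtain q where q: "strict_mono q" "convergent (\<lambda>j. Im (f (r (q j))))" using R[of "\<lambda>j. Im (f (r j))"] by blast
  obtain a where a: "(\<lambda>j. Re (f (r j))) \<longlonglongrightarrow> a" using r(2) by (auto simp: convergent_def)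
  have a': "(\<lambda>j. Re (f (r (q j)))) \<longlonglongrightarrow> a"
    using LIMSEQ_subseq_LIMSEQ[OF a q(1)] by (simp add: o_def)
  obtain b where b: "(\<lambda>j. Im (f (r (q j)))) \<longlonglongrightarrow> b" using q(2) by (auto simp: convergent_def)
  have "(\<lambda>j. f ((r \<circ> q) j)) \<longlonglongrightarrow> Complex a b"
    using tendsto_Complex[OF a' b] by simp
  moreover have "strict_mono (r \<circ> q)" using r q by (simp add: strict_mono_o)
  ultimately show ?thesis by blast
qed

lemma bounded_complex_family_subseq:
  fixes f :: "nat \<Rightarrow> 'i \<Rightarrow> complex"
  assumes "finite I" "\<And>j i. i \<in> I \<Longrightarrow> cmod (f j i) \<le> C"
  shows "\<exists>r g. strict_mono r \<and> (\<forall>i\<in>I. (\<lambda>j. f (r j) i) \<longlonglongrightarrow> g i)"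
  using assms
proof (induction I rule: finite_induct)
  case empty
  show ?case by (auto intro!: exI[of _ id] simp: strict_mono_def)
next
  case (insert i I)
  then obtain r g where r: "strict_mono r" "\<forall>i\<in>I. (\<lambda>j. f (r j) i) \<longlonglongrightarrow> g i" by auto
  obtain q l where q: "strict_mono q" "(\<lambda>j. f (r (q j)) i) \<longlonglongrightarrow> l"
    using bounded_complex_subseq[of "\<lambda>j. f (r j) i" C] insert.prems by auto
  have "(\<lambda>j. f ((r \<circ> q) j) i') \<longlonglongrightarrow> (g(i := l)) i'" if "i' \<in> insert i I" for i'
  proof (cases "i' = i")
    case False
    then have "(\<lambda>j. f (r j) i') \<longlonglongrightarrow> g i'" using r that by auto
    from LIMSEQ_subseq_LIMSEQ[OF this q(1)] show ?thesis using False by (simp add: o_def)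
  qed (use q in simp)
  moreover have "strict_mono (r \<circ> q)" using r q by (simp add: strict_mono_o)
  ultimately show ?case by blast
qed

lemma unitary_limit:
  assumes "\<And>j. unitary_mat n (U j)" "\<And>a b. a < n \<Longrightarrow> b < n \<Longrightarrow> (\<lambda>j. U j $$ (a,b)) \<longlonglongrightarrow> g a b"
  shows "unitary_mat n (mat n n (\<lambda>(a,b). g a b))"
proof -
  have "(\<Sum>p<n. cnj (g p i) * g p j) = (if i = j then 1 else 0)" if "i < n" "j < n" for i j
  proof -
    have "(\<lambda>l. \<Sum>p<n. cnj (U l $$ (p,i)) * U l $$ (p,j)) \<longlonglongrightarrow> (\<Sum>p<n. cnj (g p i) * g p j)"
      using that by (intro tendsto_sum tendsto_mult tendsto_cnj assms) auto
    then show ?thesis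
      using that by (simp add: unitary_orthonormal[OF assms(1)] LIMSEQ_const_iff)
  qed
  then show ?thesis by (subst unitary_iff_orthonormal) auto
qed

section \<open>Singular values by maximizing a weighted trace\<close>

text \<open>The matrix 1 + (w - 1) z z* multiplies z by w and fixes the orthogonal complement of z.
  These are the rank-one perturbations with which the maximizer below is tested.\<close>

lemma unitary_reflection:
  assumes z: "nrm n z = 1" and w: "cmod w = 1"
  shows "unitary_mat n (mat n n (\<lambda>(i,k). (if i = k then 1 else 0) + (w - 1) * z i * cnj (z k)))"
proof -
  have zz: "(\<Sum>p<n. cnj (z p) * z p) = 1"
  proof -
    have "complex_of_real ((nrm n z)\<^sup>2) = (\<Sum>p<n. cnj (z p) * z p)"
      unfolding nrm_sq of_real_sum complex_norm_square by (simp add: mult.commute)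
    then show ?thesis using z by simp
  qed
  have "cnj w * w = 1" using w by (metis complex_norm_square mult.commute of_real_1 power_one)
  \<comment> \<open>The coefficient of z_i cnj z_j in the product of the adjoint with the matrix; it
    equals |w|^2 - 1.\<close>
  then have ww: "(w - 1) + cnj (w - 1) + cnj (w - 1) * (w - 1) = 0" by (simp add: algebra_simps)
  have "(\<Sum>p<n. cnj ((if p = i then 1 else 0) + (w - 1) * z p * cnj (z i)) *
          ((if p = j then 1 else 0) + (w - 1) * z p * cnj (z j))) = (if i = j then 1 else 0)"
    if "i < n" "j < n" for i j
  proof -
    have "(\<Sum>p<n. cnj ((if p = i then 1 else 0) + (w - 1) * z p * cnj (z i)) *
          ((if p = j then 1 else 0) + (w - 1) * z p * cnj (z j)))
      = (\<Sum>p<n. (if p = i then (if i = j then 1 else 0) + (w - 1) * z i * cnj (z j) else 0)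
          + (if p = j then cnj (w - 1) * z i * cnj (z j) else 0)
          + cnj (w - 1) * (w - 1) * z i * cnj (z j) * (cnj (z p) * z p))"
      by (intro sum.cong refl) (auto simp: algebra_simps)
    also have "\<dots> = (if i = j then 1 else 0) + (w - 1) * z i * cnj (z j) + cnj (w - 1) * z i * cnj (z j)
         + cnj (w - 1) * (w - 1) * z i * cnj (z j)"
      using that by (simp add: sum.distrib zz flip: sum_distrib_left)
    also have "\<dots> = (if i = j then 1 else 0) + ((w - 1) + cnj (w - 1) + cnj (w - 1) * (w - 1)) * (z i * cnj (z j))"
      by (simp add: algebra_simps)
    finally show ?thesis unfolding ww by simp
  qed
  then show ?thesis by (subst unitary_iff_orthonormal) auto
qed

text \<open>The phase w that rotates h onto |h| turns the hypothesis into |h| \<le> Re h.\<close>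

lemma nonneg_if_rotations_le:
  assumes "\<And>w. cmod w = 1 \<Longrightarrow> Re ((w - 1) * h) \<le> 0"
  shows "Im h = 0 \<and> Re h \<ge> 0"
proof (cases "h = 0")
  case False
  define w where "w = cnj h / complex_of_real (cmod h)"
  have "cmod w = 1" using False by (simp add: w_def norm_divide)
  then have "Re ((w - 1) * h) \<le> 0" by (rule assms)
  moreover have "w * h = complex_of_real (cmod h)"
  proof -
    have "cnj h * h = complex_of_real (cmod h) * complex_of_real (cmod h)"
      using complex_norm_square[of h] by (simp add: power2_eq_square mult.commute)
    then show ?thesis using False by (simp add: w_def)
  qed
  ultimately have le: "cmod h \<le> Re h" by (simp only: left_diff_distrib) simp
  then have "Re h \<ge> 0" using norm_ge_zero order_trans by blast
  then have "Re h = cmod h" using le complex_Re_le_cmod[of h] by simp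
  then have "(Im h)\<^sup>2 = 0" using cmod_power2[of h] by simp
  then show ?thesis using \<open>Re h \<ge> 0\<close> by simp
qed simp

lemma sform_delta: "i < n \<Longrightarrow> j < n \<Longrightarrow>
    sform n (\<lambda>l. if l = i then 1 else 0) H (\<lambda>l. if l = j then 1 else 0) = H i j"
proof -
  assume ij: "i < n" "j < n"
  have "sform n (\<lambda>l. if l = i then 1 else 0) H (\<lambda>l. if l = j then 1 else 0)
     = (\<Sum>a<n. \<Sum>b<n. if b = j then if a = i then H i j else 0 else 0)"
    unfolding sform_def by (intro sum.cong refl) auto
  then show ?thesis using ij by simp
qed

lemma nrm_delta: "i < n \<Longrightarrow> nrm n (\<lambda>l. if l = i then 1 else 0) = 1"
proof -
  assume i: "i < n"
  have "(nrm n (\<lambda>l. if l = i then 1 else 0))\<^sup>2 = (\<Sum>l<n. if l = i then 1 else 0)"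
    unfolding nrm_sq by (intro sum.cong) auto
  also have "\<dots> = 1" using i by simp
  finally show ?thesis using nrm_nonneg[of n "\<lambda>l. if l = i then 1 else 0"] by (simp add: power2_eq_1_iff)
qed

lemma sform_add_left: "sform N (\<lambda>i. u i + u' i) a v = sform N u a v + sform N u' a v"
  unfolding sform_def by (simp add: algebra_simps sum.distrib)

lemma sform_add_right: "sform N u a (\<lambda>i. v i + v' i) = sform N u a v + sform N u a v'"
  unfolding sform_def by (simp add: algebra_simps sum.distrib)

lemma sform_scale_left: "sform N (\<lambda>i. z * u i) a v = cnj z * sform N u a v"
  unfolding sform_def by (simp add: sum_distrib_left mult_ac)

lemma sform_scale_right: "sform N u a (\<lambda>i. z * v i) = z * sform N u a v"
  unfolding sform_def by (simp add: sum_distrib_left mult_ac)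

text \<open>Polarization: homogeneity extends the hypothesis to all vectors, and the vectors e_i +
  e_j and e_i + \<i> e_j then give the imaginary and the real part of the claim.\<close>

lemma hermitian_if_real_form:
  assumes real: "\<And>z. nrm n z = 1 \<Longrightarrow> Im (sform n z H z) = 0" and ij: "i < n" "j < n"
  shows "H i j = cnj (H j i)"
proof -
  have real': "Im (sform n z H z) = 0" for z
  proof (cases "nrm n z = 0")
    case True
    then have "sform n z H z = sform n (\<lambda>_. 0) H (\<lambda>_. 0)"
      by (intro sform_cong) (auto dest: nrm_eq_0)
    then show ?thesis by (simp add: sform_def)
  next
    case False
    define s where "s = nrm n z"
    have s: "s > 0" using False nrm_nonneg[of n z] unfolding s_def by linarith
    have "nrm n (\<lambda>i. complex_of_real (inverse s) * z i) = 1"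
      using s by (simp only: nrm_scale) (simp add: s_def[symmetric] norm_inverse)
    from real[OF this] have "Im (complex_of_real (inverse s) * (complex_of_real (inverse s) * sform n z H z)) = 0"
      unfolding sform_scale_left sform_scale_right by simp
    then have "inverse s * (inverse s * Im (sform n z H z)) = 0"
      using s by auto
    then show ?thesis using s by auto
  qed
  let ?e = "\<lambda>i l. if l = i then 1 else (0::complex)"
  have ex: "sform n (\<lambda>l. ?e i l + b * ?e j l) H (\<lambda>l. ?e i l + b * ?e j l)
     = H i i + b * H i j + cnj b * H j i + cnj b * b * H j j" for b
    unfolding sform_add_left sform_add_right sform_scale_left sform_scale_right
    by (simp add: sform_delta ij algebra_simps)
  have d: "Im (H l l) = 0" if "l < n" for l
    using real'[of "?e l"] that by (simp add: sform_delta)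
  have 1: "Im (H i j) + Im (H j i) = 0"
    using real'[of "\<lambda>l. ?e i l + 1 * ?e j l"] ij unfolding ex by (simp add: d)
  have 2: "Re (H i j) - Re (H j i) = 0"
    using real'[of "\<lambda>l. ?e i l + \<i> * ?e j l"] ij unfolding ex by (simp add: d)
  show ?thesis using 1 2 by (simp add: complex_eq_iff)
qed

lemma mult3_mat_entry:
  assumes "P \<in> carrier_mat n n" "A \<in> carrier_mat n n" "Q \<in> carrier_mat n n" "i < n" "j < n"
  shows "(P * A * Q) $$ (i,j) = (\<Sum>a<n. \<Sum>b<n. P $$ (i,a) * A $$ (a,b) * Q $$ (b,j))"
  using assms by (simp add: mult_mat_entry[of _ n n _ n] mult_carrier_mat[of _ n n _ n] sum_distrib_left
      mult.assoc del: index_mult_mat)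

text \<open>\<open>F\<close> is a polynomial in the entries of P and Q, which have modulus at most
  1. Hence its supremum is finite and is attained at an entrywise limit of a maximizing sequence,
  which is again a pair of unitaries.\<close>

lemma weighted_trace_maximizer:
  fixes d :: "nat \<Rightarrow> real"
  assumes A: "A \<in> carrier_mat n n"
  defines "F \<equiv> \<lambda>P Q. Re (\<Sum>i<n. complex_of_real (d i) * (P * A * Q) $$ (i,i))"
  shows "\<exists>P Q. unitary_mat n P \<and> unitary_mat n Q \<and>
    (\<forall>P' Q'. unitary_mat n P' \<longrightarrow> unitary_mat n Q' \<longrightarrow> F P' Q' \<le> F P Q)"
proof -
  define S where "S = {F P Q | P Q. unitary_mat n P \<and> unitary_mat n Q}"
  have Fe: "F P Q = Re (\<Sum>i<n. complex_of_real (d i) * (\<Sum>a<n. \<Sum>b<n. P $$ (i,a) * A $$ (a,b) * Q $$ (b,i)))"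
    if "P \<in> carrier_mat n n" "Q \<in> carrier_mat n n" for P Q
    unfolding F_def using that A
    by (intro arg_cong[where f = Re] sum.cong refl arg_cong2[where f = times] mult3_mat_entry) auto
  have "F P Q \<le> (\<Sum>i<n. \<bar>d i\<bar> * (\<Sum>a<n. \<Sum>b<n. cmod (A $$ (a,b))))"
    if U: "unitary_mat n P" "unitary_mat n Q" for P Q
  proof -
    have 1: "cmod (P $$ (i,a) * A $$ (a,b) * Q $$ (b,i)) \<le> cmod (A $$ (a,b))" if "i < n" "a < n" "b < n" for i a b
    proof -
      have "cmod (P $$ (i,a)) * cmod (A $$ (a,b)) * cmod (Q $$ (b,i)) \<le> 1 * cmod (A $$ (a,b)) * 1"
        using that by (intro mult_mono unitary_entry_le[OF U(1)] unitary_entry_le[OF U(2)]) auto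
      then show ?thesis by (simp add: norm_mult)
    qed
    have 2: "cmod (\<Sum>a<n. \<Sum>b<n. P $$ (i,a) * A $$ (a,b) * Q $$ (b,i)) \<le> (\<Sum>a<n. \<Sum>b<n. cmod (A $$ (a,b)))"
      if "i < n" for i
      using that by (intro sum_norm_le 1) auto
    have "F P Q \<le> cmod (\<Sum>i<n. complex_of_real (d i) * (\<Sum>a<n. \<Sum>b<n. P $$ (i,a) * A $$ (a,b) * Q $$ (b,i)))"
      unfolding Fe[OF unitary_carrier[OF U(1)] unitary_carrier[OF U(2)]] by (rule complex_Re_le_cmod)
    also have "\<dots> \<le> (\<Sum>i<n. \<bar>d i\<bar> * (\<Sum>a<n. \<Sum>b<n. cmod (A $$ (a,b))))"
      using 2 by (intro sum_norm_le) (auto simp: norm_mult intro!: mult_left_mono)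
    finally show ?thesis .
  qed
  then have bdd: "bdd_above S" unfolding S_def by (intro bdd_aboveI) auto
  have "\<exists>P Q. unitary_mat n P \<and> unitary_mat n Q \<and> Sup S - 1 / real (Suc j) < F P Q" for j
  proof -
    have "Sup S - 1 / real (Suc j) < Sup S" by simp
    moreover have "S \<noteq> {}" using unitary_one unfolding S_def by blast
    ultimately obtain x where "x \<in> S" "Sup S - 1 / real (Suc j) < x" by (rule less_cSupE)
    then show ?thesis by (auto simp: S_def)
  qed
  then obtain P Q where PQ: "\<And>j. unitary_mat n (P j)" "\<And>j. unitary_mat n (Q j)"
    "\<And>j. Sup S - 1 / real (Suc j) < F (P j) (Q j)" by metis
  \<comment> \<open>The Boolean component merges both matrices into one finite family, so that a
    single subsequence serves P and Q.\<close>
  define f where "f = (\<lambda>j (c,a,b). (if c then P j else Q j) $$ (a,b))"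
  have "\<exists>r g. strict_mono r \<and> (\<forall>i\<in>UNIV \<times> {..<n} \<times> {..<n}. (\<lambda>j. f (r j) i) \<longlonglongrightarrow> g i)"
    by (rule bounded_complex_family_subseq[where C = 1])
      (auto simp: f_def unitary_entry_le[OF PQ(1)] unitary_entry_le[OF PQ(2)])
  then obtain r g where r: "strict_mono r"
    and g: "\<And>c a b. a < n \<Longrightarrow> b < n \<Longrightarrow> (\<lambda>j. f (r j) (c,a,b)) \<longlonglongrightarrow> g (c,a,b)" by fastforce
  define P' where "P' = mat n n (\<lambda>(a,b). g (True,a,b))"
  define Q' where "Q' = mat n n (\<lambda>(a,b). g (False,a,b))"
  have lP: "(\<lambda>j. P (r j) $$ (a,b)) \<longlonglongrightarrow> P' $$ (a,b)" if "a < n" "b < n" for a b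
    using g[OF that, of True] that by (simp add: f_def P'_def)
  have lQ: "(\<lambda>j. Q (r j) $$ (a,b)) \<longlonglongrightarrow> Q' $$ (a,b)" if "a < n" "b < n" for a b
    using g[OF that, of False] that by (simp add: f_def Q'_def)
  have UP: "unitary_mat n P'"
    unfolding P'_def by (rule unitary_limit[where U = "\<lambda>j. P (r j)"]) (use PQ lP in \<open>auto simp: P'_def\<close>)
  have UQ: "unitary_mat n Q'"
    unfolding Q'_def by (rule unitary_limit[where U = "\<lambda>j. Q (r j)"]) (use PQ lQ in \<open>auto simp: Q'_def\<close>)
  have "(\<lambda>j. F (P (r j)) (Q (r j))) \<longlonglongrightarrow> F P' Q'"
    unfolding Fe[OF unitary_carrier[OF PQ(1)] unitary_carrier[OF PQ(2)]] Fe[OF unitary_carrier[OF UP] unitary_carrier[OF UQ]]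
    by (intro tendsto_Re tendsto_sum tendsto_mult tendsto_const lP lQ) auto
  moreover have "(\<lambda>j. Sup S - 1 / real (Suc (r j))) \<longlonglongrightarrow> Sup S - 0"
  proof -
    have "(\<lambda>j. 1 / real (Suc j)) \<longlonglongrightarrow> 0" by (rule LIMSEQ_Suc[OF lim_1_over_n])
    from LIMSEQ_subseq_LIMSEQ[OF this r] show ?thesis by (intro tendsto_diff tendsto_const) (simp add: o_def)
  qed
  ultimately have "Sup S - 0 \<le> F P' Q'"
    using PQ(3) by (intro LIMSEQ_le) (auto intro!: exI[of _ 0] less_imp_le)
  moreover have "F P'' Q'' \<le> Sup S" if "unitary_mat n P''" "unitary_mat n Q''" for P'' Q''
    using that by (intro cSup_upper bdd) (auto simp: S_def)
  ultimately show ?thesis using UP UQ by (metis diff_zero order_trans)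
qed

text \<open>At a maximizer of Re tr(D P A Q) over pairs of unitaries, with D = diag(1, ..., n), both M D and
  D M are positive for M = P A Q, because multiplying P or Q by a rank-one perturbation of the
  identity cannot increase the trace. As the entries of D are distinct, M is diagonal.\<close>

lemma singular_value_decomposition:
  assumes A: "A \<in> carrier_mat n n"
  shows "\<exists>P Q \<sigma>. unitary_mat n P \<and> unitary_mat n Q \<and> (\<forall>i<n. \<sigma> i \<ge> 0) \<and>
    P * A * Q = mat n n (\<lambda>(i,j). if i = j then complex_of_real (\<sigma> i) else 0)"
proof -
  \<comment> \<open>Starting at 1 rather than 0 makes the weights positive as well as distinct:
    distinct weights have distinct squares, and the sign of M_ii can be recovered from that of M_ii
    d_i.\<close>
  define d where "d i = real (Suc i)" for i
  define D where "D i = complex_of_real (d i)" for i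
  obtain P Q where P: "unitary_mat n P" and Q: "unitary_mat n Q" and
    max: "\<And>P' Q'. unitary_mat n P' \<Longrightarrow> unitary_mat n Q' \<Longrightarrow>
      Re (\<Sum>i<n. D i * (P' * A * Q') $$ (i,i)) \<le> Re (\<Sum>i<n. D i * (P * A * Q) $$ (i,i))"
    using weighted_trace_maximizer[OF A, of d] unfolding D_def by blast
  define M where "M = P * A * Q"
  note c = A unitary_carrier[OF P] unitary_carrier[OF Q]
  have M: "M \<in> carrier_mat n n" using c by (simp add: M_def)
  let ?U = "\<lambda>w z. mat n n (\<lambda>(i,k). (if i = k then 1 else 0) + (w - 1) * z i * cnj (z k))"
  have Uc: "?U w z \<in> carrier_mat n n" for w z by simp
  have left: "Im (sform n z (\<lambda>i j. M $$ (i,j) * D j) z) = 0 \<and> Re (sform n z (\<lambda>i j. M $$ (i,j) * D j) z) \<ge> 0"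
    if z: "nrm n z = 1" for z
  proof (rule nonneg_if_rotations_le)
    fix w :: complex assume w: "cmod w = 1"
    let ?h = "sform n z (\<lambda>i j. M $$ (i,j) * D j) z"
    have "?U w z * P * A * Q = ?U w z * M"
      unfolding M_def using c by (simp add: assoc_mult_mat[of _ n n _ n _ n] mult_carrier_mat[of _ n n _ n])
    then have "Re (\<Sum>i<n. D i * (?U w z * M) $$ (i,i)) \<le> Re (\<Sum>i<n. D i * M $$ (i,i))"
      using max[OF unitary_mult[OF unitary_reflection[OF z w] P] Q] by (simp add: M_def)
    \<comment> \<open>The perturbation contributes (w - 1) tr(D z z* M), and cyclicity of the trace
      makes this (w - 1) times the form of M D at z.\<close>
    moreover have "(\<Sum>i<n. D i * (?U w z * M) $$ (i,i)) = (\<Sum>i<n. D i * M $$ (i,i)) + (w - 1) * ?h"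
    proof -
      have e: "(?U w z * M) $$ (i,i) = M $$ (i,i) + (\<Sum>k<n. (w - 1) * z i * cnj (z k) * M $$ (k,i))" if "i < n" for i
      proof -
        have "(?U w z * M) $$ (i,i) = (\<Sum>k<n. (if k = i then M $$ (i,i) else 0) + (w - 1) * z i * cnj (z k) * M $$ (k,i))"
          unfolding mult_mat_entry[OF Uc M that that]
          by (intro sum.cong refl) (use that in \<open>auto simp: algebra_simps\<close>)
        then show ?thesis using that by (simp add: sum.distrib)
      qed
      have "(\<Sum>i<n. D i * (?U w z * M) $$ (i,i)) = (\<Sum>i<n. D i * (M $$ (i,i) + (\<Sum>k<n. (w - 1) * z i * cnj (z k) * M $$ (k,i))))"
        using e by (intro sum.cong refl) auto
      also have "\<dots> = (\<Sum>i<n. D i * M $$ (i,i)) + (\<Sum>i<n. \<Sum>k<n. (w - 1) * (cnj (z k) * (M $$ (k,i) * D i) * z i))"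
        by (simp add: distrib_left sum.distrib sum_distrib_left mult_ac)
      also have "(\<Sum>i<n. \<Sum>k<n. (w - 1) * (cnj (z k) * (M $$ (k,i) * D i) * z i)) = (w - 1) * ?h"
        unfolding sform_def sum_distrib_left by (rule sum.swap)
      finally show ?thesis .
    qed
    ultimately show "Re ((w - 1) * ?h) \<le> 0" by (simp only: plus_complex.sel)
  qed
  have right: "Im (sform n z (\<lambda>i j. D i * M $$ (i,j)) z) = 0" if z: "nrm n z = 1" for z
  proof -
    let ?h = "sform n z (\<lambda>i j. D i * M $$ (i,j)) z"
    have "Im ?h = 0 \<and> Re ?h \<ge> 0"
    proof (rule nonneg_if_rotations_le)
      fix w :: complex assume w: "cmod w = 1"
      have "P * A * (Q * ?U w z) = M * ?U w z"
        unfolding M_def using c by (simp add: assoc_mult_mat[of _ n n _ n _ n] mult_carrier_mat[of _ n n _ n])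
      then have "Re (\<Sum>i<n. D i * (M * ?U w z) $$ (i,i)) \<le> Re (\<Sum>i<n. D i * M $$ (i,i))"
        using max[OF P unitary_mult[OF Q unitary_reflection[OF z w]]] by (simp add: M_def)
      moreover have "(\<Sum>i<n. D i * (M * ?U w z) $$ (i,i)) = (\<Sum>i<n. D i * M $$ (i,i)) + (w - 1) * ?h"
      proof -
        have e: "(M * ?U w z) $$ (i,i) = M $$ (i,i) + (\<Sum>k<n. M $$ (i,k) * ((w - 1) * z k * cnj (z i)))" if "i < n" for i
        proof -
          have "(M * ?U w z) $$ (i,i) = (\<Sum>k<n. (if k = i then M $$ (i,i) else 0) + M $$ (i,k) * ((w - 1) * z k * cnj (z i)))"
            unfolding mult_mat_entry[OF M Uc that that]
            by (intro sum.cong refl) (use that in \<open>auto simp: algebra_simps\<close>)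
          then show ?thesis using that by (simp add: sum.distrib)
        qed
        have "(\<Sum>i<n. D i * (M * ?U w z) $$ (i,i)) = (\<Sum>i<n. D i * (M $$ (i,i) + (\<Sum>k<n. M $$ (i,k) * ((w - 1) * z k * cnj (z i)))))"
          using e by (intro sum.cong refl) auto
        also have "\<dots> = (\<Sum>i<n. D i * M $$ (i,i)) + (\<Sum>i<n. \<Sum>k<n. (w - 1) * (cnj (z i) * (D i * M $$ (i,k)) * z k))"
          by (simp add: distrib_left sum.distrib sum_distrib_left mult_ac)
        also have "(\<Sum>i<n. \<Sum>k<n. (w - 1) * (cnj (z i) * (D i * M $$ (i,k)) * z k)) = (w - 1) * ?h"
          unfolding sform_def sum_distrib_left ..
        finally show ?thesis .
      qed
      ultimately show "Re ((w - 1) * ?h) \<le> 0" by (simp only: plus_complex.sel)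
    qed
    then show ?thesis by simp
  qed
  have cD: "cnj (D i) = D i" for i by (simp add: D_def)
  have off: "M $$ (i,j) = 0" if "i < n" "j < n" "i \<noteq> j" for i j
  proof -
    have 1: "M $$ (i,j) * D j = cnj (M $$ (j,i)) * D i"
      using hermitian_if_real_form[of n "\<lambda>i j. M $$ (i,j) * D j", OF _ that(1,2)] left by (simp add: cD)
    have 2: "D i * M $$ (i,j) = D j * cnj (M $$ (j,i))"
      using hermitian_if_real_form[of n "\<lambda>i j. D i * M $$ (i,j)", OF _ that(1,2)] right by (simp add: cD)
    \<comment> \<open>The two relations say M D = D M* and D M = M* D; together they make M commute
      with the square of D.\<close>
    have "D j * D j * M $$ (i,j) = D j * (cnj (M $$ (j,i)) * D i)" by (simp flip: 1)
    also have "\<dots> = D i * D i * M $$ (i,j)" by (simp add: mult.assoc 2 mult_ac)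
    finally have "(D j * D j - D i * D i) * M $$ (i,j) = 0" by (simp add: algebra_simps)
    moreover have "D j * D j - D i * D i = complex_of_real (d j * d j - d i * d i)" by (simp add: D_def)
    moreover have "d j * d j - d i * d i \<noteq> 0"
    proof -
      have "(d j - d i) * (d j + d i) \<noteq> 0" using that(3) unfolding d_def by simp
      then show ?thesis by (simp add: algebra_simps)
    qed
    ultimately show ?thesis by (metis mult_eq_0_iff of_real_eq_0_iff)
  qed
  define \<sigma> where "\<sigma> i = Re (M $$ (i,i))" for i
  have diag: "M $$ (i,i) = complex_of_real (\<sigma> i) \<and> \<sigma> i \<ge> 0" if i: "i < n" for i
  proof -
    have "Im (M $$ (i,i) * D i) = 0 \<and> Re (M $$ (i,i) * D i) \<ge> 0"
      using left[OF nrm_delta[OF i]] unfolding sform_delta[OF i i] .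
    moreover have "d i > 0" by (simp add: d_def)
    ultimately show ?thesis
      by (auto simp: D_def \<sigma>_def complex_eq_iff zero_le_mult_iff)
  qed
  have "M = mat n n (\<lambda>(i,j). if i = j then complex_of_real (\<sigma> i) else 0)"
    using M off diag by (intro eq_matI) auto
  then show ?thesis using P Q diag unfolding M_def by blast
qed

section \<open>Contractions as averages of two unitaries\<close>

lemma unitary_diag:
  assumes "\<And>i. i < n \<Longrightarrow> cmod (\<phi> i) = 1"
  shows "unitary_mat n (mat n n (\<lambda>(i,j). if i = j then \<phi> i else 0))"
proof -
  have "(\<Sum>p<n. cnj (if p = i then \<phi> p else 0) * (if p = j then \<phi> p else 0)) = (if i = j then 1 else 0)"
    if "i < n" "j < n" for i j
  proof -
    have "(\<Sum>p<n. cnj (if p = i then \<phi> p else 0) * (if p = j then \<phi> p else 0))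
       = (\<Sum>p<n. if p = i then (if i = j then \<phi> i * cnj (\<phi> i) else 0) else 0)"
      by (intro sum.cong refl) auto
    also have "\<phi> i * cnj (\<phi> i) = 1" using assms[OF that(1)] complex_norm_square[of "\<phi> i"] by simp
    finally show ?thesis using that by simp
  qed
  then show ?thesis by (subst unitary_iff_orthonormal) auto
qed

text \<open>With the singular value decomposition A = P \<Sigma> Q, take B = P sqrt(1 - \<Sigma> \<Sigma>) Q and W1, W2 = A \<plusminus> i B.\<close>

lemma contraction_unitary_dilation:
  assumes A: "A \<in> carrier_mat n n" and contr: "form_bound n (\<lambda>i j. A $$ (i,j)) 1"
  shows "\<exists>W1 W2 B. unitary_mat n W1 \<and> unitary_mat n W2 \<and>
    (\<forall>p<n. \<forall>q<n. \<forall>r<n. \<forall>s<n. cnj (A $$ (p,r)) * A $$ (q,s) =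
       (cnj (W1 $$ (p,r)) * W1 $$ (q,s) + cnj (W2 $$ (p,r)) * W2 $$ (q,s)) / 2 - cnj (B $$ (p,r)) * B $$ (q,s)) \<and>
    (\<forall>r<n. \<forall>s<n. (\<Sum>p<n. cnj (B $$ (p,r)) * B $$ (p,s)) =
       (if r = s then 1 else 0) - (\<Sum>p<n. cnj (A $$ (p,r)) * A $$ (p,s)))"
proof -
  obtain P Q \<sigma> where P: "unitary_mat n P" and Q: "unitary_mat n Q" and \<sigma>: "\<And>i. i < n \<Longrightarrow> \<sigma> i \<ge> 0"
    and S: "P * A * Q = mat n n (\<lambda>(i,j). if i = j then complex_of_real (\<sigma> i) else 0)"
    using singular_value_decomposition[OF A] by blast
  note c = A unitary_carrier[OF P] unitary_carrier[OF Q]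
  define P' Q' where "P' = ctrans P" and "Q' = ctrans Q"
  have P': "unitary_mat n P'" and Q': "unitary_mat n Q'" using P Q unitary_ctrans by (auto simp: P'_def Q'_def)
  note c' = unitary_carrier[OF P'] unitary_carrier[OF Q']
  define Dg where "Dg \<phi> = mat n n (\<lambda>(i,j). if i = j then \<phi> i else (0::complex))" for \<phi>
  have Dgc: "Dg \<phi> \<in> carrier_mat n n" for \<phi> by (simp add: Dg_def)
  define X where "X \<phi> = P' * Dg \<phi> * Q'" for \<phi>
  have Xe: "X \<phi> $$ (i,j) = (\<Sum>k<n. P' $$ (i,k) * \<phi> k * Q' $$ (k,j))" if "i < n" "j < n" for \<phi> i j
  proof -
    have "X \<phi> $$ (i,j) = (\<Sum>a<n. \<Sum>b<n. if b = a then P' $$ (i,a) * \<phi> a * Q' $$ (a,j) else 0)"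
      unfolding X_def mult3_mat_entry[OF c'(1) Dgc c'(2) that]
      by (intro sum.cong refl) (auto simp: Dg_def)
    then show ?thesis by simp
  qed
  have AX: "A = X (\<lambda>i. complex_of_real (\<sigma> i))"
  proof -
    have "P' * (P * A * Q) * Q' = (P' * P) * A * (Q * Q')"
      using c c' by (simp add: assoc_mult_mat[of _ n n _ n _ n] mult_carrier_mat[of _ n n _ n])
    also have "\<dots> = A" using P Q c by (simp add: P'_def Q'_def unitary_mat_def)
    finally show ?thesis by (simp add: X_def Dg_def S)
  qed
  \<comment> \<open>A singular value is the form of A at two unit vectors, a column of P' and a
    column of Q, so contractivity bounds it by 1.\<close>
  have s1: "\<sigma> i \<le> 1" if i: "i < n" for i
  proof -
    have "complex_of_real (\<sigma> i) = (P * A * Q) $$ (i,i)" using i by (simp add: S)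
    also have "\<dots> = sform n (\<lambda>a. P' $$ (a,i)) (\<lambda>i j. A $$ (i,j)) (\<lambda>b. Q $$ (b,i))"
      unfolding sform_def mult3_mat_entry[OF c(2,1,3) i i]
      using i c by (intro sum.cong refl) (simp add: P'_def ctrans_entry[of _ n n])
    finally have "cmod (complex_of_real (\<sigma> i)) \<le> 1 * nrm n (\<lambda>a. P' $$ (a,i)) * nrm n (\<lambda>b. Q $$ (b,i))"
      using contr unfolding form_bound_def by metis
    then show ?thesis using \<sigma>[OF i] by (simp add: unitary_column_nrm[OF P' i] unitary_column_nrm[OF Q i])
  qed
  define s where "s i = sqrt (1 - (\<sigma> i)\<^sup>2)" for i
  \<comment> \<open>The numbers \<open>Complex (\<sigma> i) (s i)\<close> and
    \<open>Complex (\<sigma> i) (- s i)\<close> lie on the unit circle, so the diagonal middle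
    factors of \<open>W1\<close> and \<open>W2\<close> are unitary.\<close>
  define W1 W2 B where "W1 = X (\<lambda>i. Complex (\<sigma> i) (s i))" and "W2 = X (\<lambda>i. Complex (\<sigma> i) (- s i))"
    and "B = X (\<lambda>i. complex_of_real (s i))"
  have ss: "(\<sigma> i)\<^sup>2 + (s i)\<^sup>2 = 1" if "i < n" for i
    using \<sigma>[OF that] s1[OF that] by (simp add: s_def power_le_one)
  have XU: "unitary_mat n (X \<phi>)" if "\<And>i. i < n \<Longrightarrow> cmod (\<phi> i) = 1" for \<phi>
    unfolding X_def Dg_def by (intro unitary_mult P' Q' unitary_diag that)
  have U: "unitary_mat n W1" "unitary_mat n W2"
    unfolding W1_def W2_def by (intro XU; simp add: complex_norm ss)+
  have e1: "W1 $$ (i,j) = A $$ (i,j) + \<i> * B $$ (i,j)" if "i < n" "j < n" for i j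
    unfolding W1_def B_def Xe[OF that] AX
    by (simp add: sum_distrib_left sum.distrib[symmetric] Complex_eq algebra_simps)
  have e2: "W2 $$ (i,j) = A $$ (i,j) - \<i> * B $$ (i,j)" if "i < n" "j < n" for i j
    unfolding W2_def B_def Xe[OF that] AX
    by (simp add: sum_distrib_left sum_subtractf[symmetric] Complex_eq algebra_simps)
  \<comment> \<open>In the average over A + \<i> B and A - \<i> B the mixed terms of A and B
    cancel.\<close>
  have id: "cnj (A $$ (p,r)) * A $$ (q,s) =
       (cnj (W1 $$ (p,r)) * W1 $$ (q,s) + cnj (W2 $$ (p,r)) * W2 $$ (q,s)) / 2 - cnj (B $$ (p,r)) * B $$ (q,s)"
    if "p < n" "q < n" "r < n" "s < n" for p q r s
    using that by (simp add: e1 e2 field_simps)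
  have "(\<Sum>p<n. cnj (B $$ (p,r)) * B $$ (p,s)) = (if r = s then 1 else 0) - (\<Sum>p<n. cnj (A $$ (p,r)) * A $$ (p,s))"
    if "r < n" "s < n" for r s
  proof -
    have "(\<Sum>p<n. cnj (A $$ (p,r)) * A $$ (p,s)) =
      ((\<Sum>p<n. cnj (W1 $$ (p,r)) * W1 $$ (p,s)) + (\<Sum>p<n. cnj (W2 $$ (p,r)) * W2 $$ (p,s))) / 2
       - (\<Sum>p<n. cnj (B $$ (p,r)) * B $$ (p,s))"
      unfolding sum.distrib[symmetric] sum_divide_distrib sum_subtractf[symmetric]
      using that by (intro sum.cong refl id) auto
    then show ?thesis using that by (simp add: unitary_orthonormal[OF U(1)] unitary_orthonormal[OF U(2)])
  qed
  then show ?thesis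
    using U id by (intro exI[of _ W1] exI[of _ W2] exI[of _ B] conjI allI impI)
qed

section \<open>Convex combinations of automorphisms\<close>

lemma linear_dependence:
  fixes y :: "'l \<Rightarrow> 'i \<Rightarrow> real"
  assumes "finite I" "finite L" "card L > card I"
  shows "\<exists>c. (\<exists>l\<in>L. c l \<noteq> 0) \<and> (\<forall>i\<in>I. (\<Sum>l\<in>L. c l * y l i) = 0)"
  using assms
proof (induction I arbitrary: L y rule: finite_induct)
  case empty
  then have "L \<noteq> {}" by auto
  then show ?case by (auto intro!: exI[of _ "\<lambda>_. 1"])
next
  case (insert k I)
  show ?case
  proof (cases "\<forall>l\<in>L. y l k = 0")
    case True
    obtain c where "\<exists>l\<in>L. c l \<noteq> 0" "\<forall>i\<in>I. (\<Sum>l\<in>L. c l * y l i) = 0"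
      using insert.IH[of L y] insert.prems insert.hyps by auto
    then show ?thesis using True by (intro exI[of _ c]) auto
  next
    case False
    then obtain l0 where l0: "l0 \<in> L" "y l0 k \<noteq> 0" by blast
    define L' where "L' = L - {l0}"
    \<comment> \<open>Elimination with pivot \<open>l0\<close>: coordinate \<open>k\<close> of every
      \<open>z l\<close> vanishes, so only the coordinates in \<open>I\<close> remain to be
      treated.\<close>
    define z where "z l i = y l i - y l k / y l0 k * y l0 i" for l i
    have "card L' > card I" using insert.prems insert.hyps l0 by (simp add: L'_def)
    then obtain c where c: "\<exists>l\<in>L'. c l \<noteq> 0" "\<forall>i\<in>I. (\<Sum>l\<in>L'. c l * z l i) = 0"
      using insert.IH[of L' z] insert.prems by (auto simp: L'_def)
    \<comment> \<open>The coefficient at the pivot is chosen to make coordinate \<open>k\<close> of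
      the combination vanish.\<close>
    define c' where "c' = c(l0 := - (\<Sum>l\<in>L'. c l * y l k) / y l0 k)"
    have split: "(\<Sum>l\<in>L. c' l * y l i) = c' l0 * y l0 i + (\<Sum>l\<in>L'. c l * y l i)" for i
    proof -
      have "(\<Sum>l\<in>L'. c' l * y l i) = (\<Sum>l\<in>L'. c l * y l i)"
        by (intro sum.cong refl) (auto simp: c'_def L'_def)
      then show ?thesis using insert.prems l0 by (simp add: L'_def sum.remove[of L l0])
    qed
    have z: "(\<Sum>l\<in>L'. c l * z l i) = (\<Sum>l\<in>L'. c l * y l i) - (\<Sum>l\<in>L'. c l * y l k) / y l0 k * y l0 i" for i
    proof -
      have "c l * z l i = c l * y l i - c l * y l k / y l0 k * y l0 i" for l
        by (simp add: z_def algebra_simps)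
      then show ?thesis by (simp add: sum_subtractf sum_distrib_right sum_divide_distrib)
    qed
    have "(\<Sum>l\<in>L. c' l * y l i) = 0" if "i \<in> insert k I" for i
      using that c(2) l0 z[of i] unfolding split by (auto simp: c'_def)
    moreover have "\<exists>l\<in>L. c' l \<noteq> 0" using c(1) by (auto simp: c'_def L'_def)
    ultimately show ?thesis by blast
  qed
qed

lemma caratheodory_finite:
  fixes y :: "'l \<Rightarrow> 'i \<Rightarrow> real"
  assumes I: "finite I" and "finite L" "\<And>l. l \<in> L \<Longrightarrow> lam l \<ge> 0" "(\<Sum>l\<in>L. lam l) = 1"
  shows "\<exists>L' mu. L' \<subseteq> L \<and> card L' \<le> Suc (card I) \<and> (\<forall>l\<in>L'. mu l \<ge> 0) \<and> (\<Sum>l\<in>L'. mu l) = (1::real) \<and>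
     (\<forall>i\<in>I. (\<Sum>l\<in>L'. mu l * y l i) = (\<Sum>l\<in>L. lam l * y l i))"
  using assms(2-4)
proof (induction L arbitrary: lam rule: finite_psubset_induct)
  case (psubset L)
  show ?case
  proof (cases "card L \<le> Suc (card I)")
    case True
    then show ?thesis using psubset.prems by (intro exI[of _ L] exI[of _ lam]) auto
  next
    case False
    \<comment> \<open>The extra coordinate \<open>None\<close>, constantly 1, makes the coefficients
      of the dependence sum to 0, so that shifting along it keeps the total weight.\<close>
    define y' where "y' l i = (case i of None \<Rightarrow> 1 | Some i \<Rightarrow> y l i)" for l i
    have "card (insert None (Some ` I)) = Suc (card I)"
      using I by (simp add: card_image)
    then obtain c where c: "\<exists>l\<in>L. c l \<noteq> 0" "\<forall>i\<in>insert None (Some ` I). (\<Sum>l\<in>L. c l * y' l i) = 0"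
      using linear_dependence[of "insert None (Some ` I)" L y'] I psubset.hyps False by auto
    have c0: "(\<Sum>l\<in>L. c l) = 0" using c(2) by (simp add: y'_def)
    have cy: "(\<Sum>l\<in>L. c l * y l i) = 0" if "i \<in> I" for i using c(2) that by (auto simp: y'_def)
    define L1 where "L1 = {l\<in>L. c l > 0}"
    have "L1 \<noteq> {}"
    proof
      assume "L1 = {}"
      then have "\<forall>l\<in>L. - c l \<ge> 0" by (auto simp: L1_def not_less)
      moreover have "(\<Sum>l\<in>L. - c l) = 0" using c0 by (simp add: sum_negf)
      ultimately have "\<forall>l\<in>L. - c l = 0" using sum_nonneg_eq_0_iff[of L "\<lambda>l. - c l"] psubset.hyps by blast
      then show False using c(1) by auto
    qed
    moreover have "finite L1" using psubset.hyps by (simp add: L1_def)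
    ultimately obtain l0 where l0: "l0 \<in> L1" "\<And>l. l \<in> L1 \<Longrightarrow> lam l0 / c l0 \<le> lam l / c l"
      using ex_min_if_finite[of "(\<lambda>l. lam l / c l) ` L1"] by (auto simp: not_less)
    \<comment> \<open>The largest multiple of \<open>c\<close> that can be subtracted with all
      weights staying nonnegative; it kills the weight at \<open>l0\<close>, which can then be
      dropped.\<close>
    define t where "t = lam l0 / c l0"
    have l0L: "l0 \<in> L" "c l0 > 0" using l0 by (auto simp: L1_def)
    have t0: "t \<ge> 0" using l0L psubset.prems by (simp add: t_def)
    define nu where "nu l = lam l - t * c l" for l
    have nu0: "nu l0 = 0" using l0L by (simp add: nu_def t_def)
    have nupos: "nu l \<ge> 0" if "l \<in> L" for l
    proof (cases "c l > 0")
      case True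
      then have "t \<le> lam l / c l" using l0(2) that by (simp add: L1_def t_def)
      then show ?thesis using True by (simp add: nu_def field_simps)
    next
      case False
      then have "t * c l \<le> 0" using t0 by (simp add: mult_nonneg_nonpos)
      then show ?thesis using psubset.prems(1)[OF that] by (simp add: nu_def)
    qed
    have rem: "(\<Sum>l\<in>L - {l0}. nu l * f l) = (\<Sum>l\<in>L. lam l * f l) - t * (\<Sum>l\<in>L. c l * f l)" for f
    proof -
      have "(\<Sum>l\<in>L - {l0}. nu l * f l) = (\<Sum>l\<in>L. nu l * f l)"
        using psubset.hyps l0L nu0 by (simp add: sum.remove[of L l0])
      moreover have "nu l * f l = lam l * f l - t * (c l * f l)" for l
        by (simp add: nu_def algebra_simps)
      ultimately show ?thesis by (simp add: sum_subtractf sum_distrib_left)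
    qed
    have "(\<Sum>l\<in>L - {l0}. nu l) = 1" using rem[of "\<lambda>_. 1"] psubset.prems c0 by simp
    then obtain L' mu where "L' \<subseteq> L - {l0}" "card L' \<le> Suc (card I)" "\<forall>l\<in>L'. mu l \<ge> 0" "(\<Sum>l\<in>L'. mu l) = 1"
      and e: "\<forall>i\<in>I. (\<Sum>l\<in>L'. mu l * y l i) = (\<Sum>l\<in>L - {l0}. nu l * y l i)"
      using psubset.IH[of "L - {l0}" nu] l0L nupos by blast
    moreover have "(\<Sum>l\<in>L - {l0}. nu l * y l i) = (\<Sum>l\<in>L. lam l * y l i)" if "i \<in> I" for i
      using rem[of "\<lambda>l. y l i"] cy[OF that] by simp
    ultimately show ?thesis by (intro exI[of _ L'] exI[of _ mu]) auto
  qed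
qed

section \<open>Mixtures of automorphisms and closedness of their set\<close>

definition mixture :: "nat \<Rightarrow> nat \<Rightarrow> (nat \<Rightarrow> real) \<Rightarrow> (nat \<Rightarrow> complex mat) \<Rightarrow> complex mat \<Rightarrow> complex mat" where
  "mixture d N lam U = (\<lambda>x. mat d d (\<lambda>ij. \<Sum>l<N. complex_of_real (lam l) * (ctrans (U l) * x * U l) $$ ij))"

lemma conv_aut_mixture:
  "conv_aut d = {mixture d N lam U | N lam U. (\<forall>l<N. lam l \<ge> 0 \<and> unitary_mat d (U l)) \<and> (\<Sum>l<N. lam l) = 1}"
  unfolding conv_aut_def mixture_def by blast

lemma mixture_coeff:
  assumes U: "\<And>l. l < N \<Longrightarrow> unitary_mat d (U l)" and pq: "p < d" "q < d" "r < d" "s < d"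
  shows "mapcoeff d (mixture d N lam U) p q r s
    = (\<Sum>l<N. complex_of_real (lam l) * (cnj (U l $$ (p,r)) * U l $$ (q,s)))"
proof -
  have "(ctrans (U l) * munit d p q * U l) $$ (r,s) = cnj (U l $$ (p,r)) * U l $$ (q,s)" if "l < N" for l
  proof -
    note c = unitary_carrier[OF U[OF that]]
    have m: "munit d p q \<in> carrier_mat d d" by (simp add: munit_def)
    have "(ctrans (U l) * munit d p q * U l) $$ (r,s)
      = (\<Sum>a<d. \<Sum>b<d. if b = q then if a = p then cnj (U l $$ (p,r)) * U l $$ (q,s) else 0 else 0)"
      unfolding mult3_mat_entry[OF ctrans_carrier[OF c] m c pq(3,4)]
      by (intro sum.cong refl) (use pq c in \<open>auto simp: munit_def ctrans_entry\<close>)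
    then show ?thesis using pq by simp
  qed
  then show ?thesis using pq by (simp add: mixture_def)
qed

lemma mixture_apply:
  assumes U: "\<And>l. l < N \<Longrightarrow> unitary_mat d (U l)" and x: "x \<in> carrier_mat d d" and rs: "r < d" "s < d"
  shows "mixture d N lam U x $$ (r,s) = (\<Sum>p<d. \<Sum>q<d. x $$ (p,q) * mapcoeff d (mixture d N lam U) p q r s)"
proof -
  have "(ctrans (U l) * x * U l) $$ (r,s) = (\<Sum>p<d. \<Sum>q<d. x $$ (p,q) * (cnj (U l $$ (p,r)) * U l $$ (q,s)))" if "l < N" for l
  proof -
    note c = unitary_carrier[OF U[OF that]]
    show ?thesis
      unfolding mult3_mat_entry[OF ctrans_carrier[OF c] x c rs]
      by (intro sum.cong refl) (use rs c in \<open>auto simp: ctrans_entry\<close>)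
  qed
  then have "mixture d N lam U x $$ (r,s)
    = (\<Sum>l<N. \<Sum>p<d. \<Sum>q<d. x $$ (p,q) * (complex_of_real (lam l) * (cnj (U l $$ (p,r)) * U l $$ (q,s))))"
    using rs by (simp add: mixture_def sum_distrib_left mult_ac)
  also have "\<dots> = (\<Sum>p<d. \<Sum>l<N. \<Sum>q<d. x $$ (p,q) * (complex_of_real (lam l) * (cnj (U l $$ (p,r)) * U l $$ (q,s))))"
    by (rule sum.swap)
  also have "\<dots> = (\<Sum>p<d. \<Sum>q<d. \<Sum>l<N. x $$ (p,q) * (complex_of_real (lam l) * (cnj (U l $$ (p,r)) * U l $$ (q,s))))"
    by (intro sum.cong refl sum.swap)
  also have "\<dots> = (\<Sum>p<d. \<Sum>q<d. x $$ (p,q) * mapcoeff d (mixture d N lam U) p q r s)"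
    using rs by (intro sum.cong refl) (simp add: mixture_coeff[OF U] sum_distrib_left)
  finally show ?thesis .
qed

lemma conv_aut_apply:
  assumes "R \<in> conv_aut d" "x \<in> carrier_mat d d" "r < d" "s < d"
  shows "R x $$ (r,s) = (\<Sum>p<d. \<Sum>q<d. x $$ (p,q) * mapcoeff d R p q r s)"
proof -
  obtain N lam U where "R = mixture d N lam U" "\<And>l. l < N \<Longrightarrow> unitary_mat d (U l)"
    using assms(1) unfolding conv_aut_mixture by blast
  then show ?thesis using mixture_apply[of N d U x r s lam] assms(2-4) by simp
qed

text \<open>A map on M_d has d^4 complex coefficients, thus 2*d^4 real coordinates, and Caratheodory
  adds one term. The length is the same for every \<open>R\<close>, which is what a compactness
  argument over a sequence of maps requires.\<close>

lemma conv_aut_bounded_mixture: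
  assumes "R \<in> conv_aut d"
  shows "\<exists>mu U. (\<forall>l<Suc (2*d^4). mu l \<ge> 0 \<and> unitary_mat d (U l)) \<and> (\<Sum>l<Suc (2*d^4). mu l) = 1 \<and>
    (\<forall>p<d. \<forall>q<d. \<forall>r<d. \<forall>s<d. mapcoeff d R p q r s = mapcoeff d (mixture d (Suc (2*d^4)) mu U) p q r s)"
proof -
  obtain N lam U where R: "R = mixture d N lam U" and lam: "\<And>l. l < N \<Longrightarrow> lam l \<ge> 0" "(\<Sum>l<N. lam l) = 1"
    and U: "\<And>l. l < N \<Longrightarrow> unitary_mat d (U l)"
    using assms unfolding conv_aut_mixture by blast
  define I where "I = (UNIV :: bool set) \<times> {..<d} \<times> {..<d} \<times> {..<d} \<times> {..<d}"
  define z where "z l p q r s = cnj (U l $$ (p,r)) * U l $$ (q,s)" for l p q r s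
  define y where "y l = (\<lambda>(c,p,q,r,s). if c then Re (z l p q r s) else Im (z l p q r s))" for l
  have I: "finite I" by (simp add: I_def)
  have cI: "card I = 2*d^4" by (simp add: I_def card_cartesian_product power4_eq_xxxx)
  obtain L mu where L: "L \<subseteq> {..<N}" "card L \<le> Suc (2*d^4)" and mu: "\<And>l. l \<in> L \<Longrightarrow> mu l \<ge> 0" "(\<Sum>l\<in>L. mu l) = (1::real)"
    and e: "\<And>i. i \<in> I \<Longrightarrow> (\<Sum>l\<in>L. mu l * y l i) = (\<Sum>l<N. lam l * y l i)"
    using caratheodory_finite[OF I finite_lessThan[of N], of lam y] lam unfolding cI lessThan_iff by blast
  have fL: "finite L" using L(1) finite_subset by blast
  obtain h where h: "bij_betw h {..<card L} L"
    using ex_bij_betw_nat_finite[OF fL] by (auto simp: lessThan_atLeast0)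
  \<comment> \<open>Shorter mixtures are padded with weight 0; the identity as dummy unitary keeps
    all members unitary.\<close>
  define mu' where "mu' l = (if l < card L then mu (h l) else 0)" for l
  define U' where "U' l = (if l < card L then U (h l) else 1\<^sub>m d)" for l
  have hL: "h l \<in> L" if "l < card L" for l using h that by (auto simp: bij_betw_def)
  have U': "unitary_mat d (U' l)" for l
    using hL L(1) by (auto simp: U'_def unitary_one intro!: U)
  have mu': "mu' l \<ge> 0" for l using hL mu by (simp add: mu'_def)
  have sum': "(\<Sum>l<Suc (2*d^4). f (mu' l) (U' l)) = (\<Sum>l\<in>L. f (mu l) (U l))" if "\<And>V. f 0 V = 0"
    for f :: "real \<Rightarrow> complex mat \<Rightarrow> complex"
  proof -
    have "(\<Sum>l<Suc (2*d^4). f (mu' l) (U' l)) = (\<Sum>l<card L. f (mu' l) (U' l))"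
      using L(2) that by (intro sum.mono_neutral_right) (auto simp: mu'_def)
    also have "\<dots> = (\<Sum>l<card L. f (mu (h l)) (U (h l)))"
      by (intro sum.cong refl) (auto simp: mu'_def U'_def)
    also have "\<dots> = (\<Sum>l\<in>L. f (mu l) (U l))"
      using sum.reindex_bij_betw[OF h, of "\<lambda>l. f (mu l) (U l)"] .
    finally show ?thesis .
  qed
  have "mapcoeff d R p q r s = mapcoeff d (mixture d (Suc (2*d^4)) mu' U') p q r s"
    if b: "p < d" "q < d" "r < d" "s < d" for p q r s
  proof -
    have "mapcoeff d (mixture d (Suc (2*d^4)) mu' U') p q r s
       = (\<Sum>l<Suc (2*d^4). complex_of_real (mu' l) * (cnj (U' l $$ (p,r)) * U' l $$ (q,s)))"
      using mixture_coeff[OF U' b] .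
    also have "\<dots> = (\<Sum>l\<in>L. complex_of_real (mu l) * z l p q r s)"
      unfolding z_def by (rule sum'[of "\<lambda>m V. complex_of_real m * (cnj (V $$ (p,r)) * V $$ (q,s))"]) simp
    also have "\<dots> = (\<Sum>l<N. complex_of_real (lam l) * z l p q r s)"
      using e[of "(True,p,q,r,s)"] e[of "(False,p,q,r,s)"] b
      by (simp add: complex_eq_iff y_def I_def)
    also have "\<dots> = mapcoeff d R p q r s"
      unfolding R z_def using mixture_coeff[OF U b] by simp
    finally show ?thesis ..
  qed
  moreover have "(\<Sum>l<Suc (2*d^4). mu' l) = 1"
  proof -
    have "complex_of_real (\<Sum>l<Suc (2*d^4). mu' l) = complex_of_real (\<Sum>l\<in>L. mu l)"
      unfolding of_real_sum by (rule sum'[of "\<lambda>m V. complex_of_real m"]) simp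
    then show ?thesis using mu(2) unfolding of_real_eq_iff by simp
  qed
  ultimately show ?thesis using mu' U' by blast
qed

lemma conv_aut_closed:
  assumes R: "\<And>j. R j \<in> conv_aut d"
    and lim: "\<And>p q r s. \<lbrakk>p < d; q < d; r < d; s < d\<rbrakk> \<Longrightarrow> (\<lambda>j. mapcoeff d (R j) p q r s) \<longlonglongrightarrow> t p q r s"
  shows "\<exists>R'\<in>conv_aut d. \<forall>p<d. \<forall>q<d. \<forall>r<d. \<forall>s<d. mapcoeff d R' p q r s = t p q r s"
proof -
  define M where "M = Suc (2*d^4)"
  have "\<forall>j. \<exists>mu U. (\<forall>l<M. mu l \<ge> 0 \<and> unitary_mat d (U l)) \<and> (\<Sum>l<M. mu l) = 1 \<and>
    (\<forall>p<d. \<forall>q<d. \<forall>r<d. \<forall>s<d. mapcoeff d (R j) p q r s = mapcoeff d (mixture d M mu U) p q r s)"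
    unfolding M_def using conv_aut_bounded_mixture[OF R] by blast
  then obtain mu U where mu: "\<And>j l. l < M \<Longrightarrow> mu j l \<ge> 0" "\<And>j. (\<Sum>l<M. mu j l) = 1"
    and U: "\<And>j l. l < M \<Longrightarrow> unitary_mat d (U j l)"
    and co: "\<And>j p q r s. \<lbrakk>p < d; q < d; r < d; s < d\<rbrakk> \<Longrightarrow>
        mapcoeff d (R j) p q r s = mapcoeff d (mixture d M (mu j) (U j)) p q r s"
    by metis
  \<comment> \<open>Weights and matrix entries form one finite family bounded by 1, so one
    subsequence makes all of them converge.\<close>
  define f where "f j i = (case i of Inl l \<Rightarrow> complex_of_real (mu j l) | Inr (l,a,b) \<Rightarrow> U j l $$ (a,b))" for j i
  have mu1: "mu j l \<le> 1" if "l < M" for j l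
    using member_le_sum[of l "{..<M}" "mu j"] mu that by auto
  have "\<exists>r g. strict_mono r \<and> (\<forall>i\<in>{..<M} <+> ({..<M} \<times> {..<d} \<times> {..<d}). (\<lambda>j. f (r j) i) \<longlonglongrightarrow> g i)"
    by (rule bounded_complex_family_subseq[where C = 1])
      (auto simp: f_def mu mu1 intro!: unitary_entry_le U)
  then obtain r g where r: "strict_mono r"
    and g: "\<And>i. i \<in> {..<M} <+> ({..<M} \<times> {..<d} \<times> {..<d}) \<Longrightarrow> (\<lambda>j. f (r j) i) \<longlonglongrightarrow> g i" by blast
  define lam where "lam l = Re (g (Inl l))" for l
  define V where "V l = mat d d (\<lambda>(a,b). g (Inr (l,a,b)))" for l
  have l1: "(\<lambda>j. mu (r j) l) \<longlonglongrightarrow> lam l" if "l < M" for l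
    using tendsto_Re[OF g[of "Inl l"]] that by (auto simp: f_def lam_def)
  have l2: "(\<lambda>j. U (r j) l $$ (a,b)) \<longlonglongrightarrow> V l $$ (a,b)" if "l < M" "a < d" "b < d" for l a b
    using g[of "Inr (l,a,b)"] that by (auto simp: f_def V_def)
  have V: "unitary_mat d (V l)" if "l < M" for l
    unfolding V_def
    by (rule unitary_limit[where U = "\<lambda>j. U (r j) l"]) (use U that l2 in \<open>auto simp: V_def\<close>)
  have lam0: "lam l \<ge> 0" if "l < M" for l
    using LIMSEQ_le_const[OF l1[OF that], of 0] mu that by auto
  have "(\<lambda>j. \<Sum>l<M. mu (r j) l) \<longlonglongrightarrow> (\<Sum>l<M. lam l)" by (intro tendsto_sum l1) auto
  then have lam1: "(\<Sum>l<M. lam l) = 1" by (simp add: mu LIMSEQ_const_iff)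
  have "mapcoeff d (mixture d M lam V) p q a b = t p q a b" if b: "p < d" "q < d" "a < d" "b < d" for p q a b
  proof (rule LIMSEQ_unique)
    have mU: "mapcoeff d (mixture d M (mu j) (U j)) p q a b
        = (\<Sum>l<M. complex_of_real (mu j l) * (cnj (U j l $$ (p,a)) * U j l $$ (q,b)))" for j
      by (rule mixture_coeff) (use U b in auto)
    have mV: "mapcoeff d (mixture d M lam V) p q a b
        = (\<Sum>l<M. complex_of_real (lam l) * (cnj (V l $$ (p,a)) * V l $$ (q,b)))"
      by (rule mixture_coeff) (use V b in auto)
    show "(\<lambda>j. mapcoeff d (R (r j)) p q a b) \<longlonglongrightarrow> t p q a b"
      using LIMSEQ_subseq_LIMSEQ[OF lim[OF b] r] by (simp add: o_def)
    show "(\<lambda>j. mapcoeff d (R (r j)) p q a b) \<longlonglongrightarrow> mapcoeff d (mixture d M lam V) p q a b"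
      unfolding co[OF b] mU mV
      using b by (intro tendsto_sum tendsto_mult tendsto_of_real tendsto_cnj l1 l2) auto
  qed
  moreover have "mixture d M lam V \<in> conv_aut d"
    unfolding conv_aut_mixture using lam0 lam1 V by blast
  ultimately show ?thesis by blast
qed

section \<open>The distance estimate\<close>

text \<open>The bound is tested, with m = 1, on the contraction E_pq and the unit vectors e_r, e_s.
  It turns convergence in cb-norm into convergence of all coefficients.\<close>

lemma cb_bound_entry:
  assumes t: "cb_bound d t c" and b: "p < d" "q < d" "r < d" "s < d"
  shows "cmod (t p q r s) \<le> c"
proof -
  define x :: "nat \<Rightarrow> nat \<Rightarrow> complex" where "x i j = (if i = p \<and> j = q then 1 else 0)" for i j
  have "form_bound d x 1"
    unfolding form_bound_def
  proof (intro allI)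
    fix u v
    have "sform d u x v = (\<Sum>i<d. \<Sum>j<d. if j = q then if i = p then cnj (u p) * v q else 0 else 0)"
      unfolding sform_def x_def by (intro sum.cong refl) auto
    then have "sform d u x v = cnj (u p) * v q" using b by simp
    moreover have "cmod (u p) \<le> nrm d u" "cmod (v q) \<le> nrm d v"
      using b member_le_L2_set[of "{..<d}" _ "\<lambda>i. cmod (u i)"] member_le_L2_set[of "{..<d}" _ "\<lambda>i. cmod (v i)"]
      by (auto simp: nrm_def)
    ultimately show "cmod (sform d u x v) \<le> 1 * nrm d u * nrm d v"
      by (simp add: norm_mult mult_mono)
  qed
  then have "form_bound d (amp d t x) c" using cb_boundD[OF t, of 1 x] by simp
  then have "cmod (sform d (\<lambda>l. if l = r then 1 else 0) (amp d t x) (\<lambda>l. if l = s then 1 else 0)) \<le> c * 1 * 1"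
    unfolding form_bound_def using nrm_delta[OF b(3)] nrm_delta[OF b(4)] by metis
  moreover have "amp d t x r s = t p q r s"
  proof -
    have "amp d t x r s = (\<Sum>i<d. \<Sum>j<d. if j = q then if i = p then t p q r s else 0 else 0)"
      unfolding amp_def x_def using b by (intro sum.cong refl) auto
    then show ?thesis using b by simp
  qed
  ultimately show ?thesis by (simp add: sform_delta b)
qed

lemma form_bound_identity: "form_bound d (\<lambda>i j. if i = j then 1 else 0) 1"
  using unitary_form_bound[OF unitary_one[of d]]
  by (subst (asm) form_bound_cong[where a' = "\<lambda>i j. if i = j then 1 else 0"]) auto

lemma conv_aut_carrier: "R \<in> conv_aut d \<Longrightarrow> R x \<in> carrier_mat d d"
  by (auto simp: conv_aut_def)

lemma closed_map_diff: "closed_map d T \<Longrightarrow> R \<in> conv_aut d \<Longrightarrow> closed_map d (\<lambda>x. T x - R x)"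
  unfolding closed_map_def by (blast intro: minus_carrier_mat conv_aut_carrier)

lemma mapcoeff_diff:
  assumes "R \<in> conv_aut d" "r < d" "s < d"
  shows "mapcoeff d (\<lambda>x. T x - R x) p q r s = mapcoeff d T p q r s - mapcoeff d R p q r s"
  using assms conv_aut_carrier[OF assms(1), of "munit d p q"] by auto

lemma conv_aut_nonempty: "conv_aut d \<noteq> {}"
proof -
  have "mixture d 1 (\<lambda>_. 1) (\<lambda>_. 1\<^sub>m d) \<in> conv_aut d"
    unfolding conv_aut_mixture using unitary_one by fastforce
  then show ?thesis by blast
qed

lemma d_cb_le:
  assumes "closed_map d T" "d \<ge> 1" "R \<in> conv_aut d"
  shows "d_cb d T (conv_aut d) \<le> cb_norm d (\<lambda>x. T x - R x)"
  unfolding d_cb_def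
  using assms cb_norm_nonneg[OF closed_map_diff[OF assms(1)] assms(2)]
  by (intro cInf_lower bdd_belowI[of _ 0]) auto

lemma d_cb_nonneg:
  assumes "closed_map d T" "d \<ge> 1"
  shows "d_cb d T (conv_aut d) \<ge> 0"
  unfolding d_cb_def
  using conv_aut_nonempty cb_norm_nonneg[OF closed_map_diff[OF assms(1)] assms(2)]
  by (intro cInf_greatest) auto

text \<open>The index p*k stands for (p,0), so the left side is the entry at (r,0), (s,0) of the
  image of E_pq \<otimes> E_00, where a single term of the fourfold sum survives.\<close>

lemma tensor_map_corner:
  assumes T: "closed_map n T" and S: "closed_map k S" and k: "k \<ge> 1"
    and b: "p < n" "q < n" "r < n" "s < n"
  shows "mapcoeff (n*k) (tensor_map n k T S) (p*k) (q*k) (r*k) (s*k)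
     = mapcoeff n T p q r s * mapcoeff k S 0 0 0 0"
proof -
  have lt: "r*k < n*k" "s*k < n*k" using b k by auto
  have lt2: "i*k+p' < n*k" if "i < n" "p' < k" for i p'
  proof -
    have "Suc i * k \<le> n * k" using that by (intro mult_le_mono1) simp
    then show ?thesis using that by simp
  qed
  have eq: "i*k+p' = p*k \<longleftrightarrow> i = p \<and> p' = 0" if "p' < k" for i p p'
  proof
    assume e: "i*k+p' = p*k"
    have "i = (i*k+p') div k" using that by simp
    also have "\<dots> = p" unfolding e using k by simp
    finally show "i = p \<and> p' = 0" using e by simp
  qed simp
  have "mapcoeff (n*k) (tensor_map n k T S) (p*k) (q*k) (r*k) (s*k)
    = (\<Sum>i<n. \<Sum>j<n. \<Sum>p'<k. \<Sum>q'<k. if q' = 0 then if p' = 0 then if j = q then if i = p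
         then mapcoeff n T p q r s * mapcoeff k S 0 0 0 0 else 0 else 0 else 0 else 0)"
    unfolding tensor_map_entry[OF T S lt]
    by (intro sum.cong refl) (use k in \<open>auto simp: munit_def lt2 eq\<close>)
  also have "\<dots> = mapcoeff n T p q r s * mapcoeff k S 0 0 0 0"
    using b k by simp
  finally show ?thesis .
qed

text \<open>The \<open>B l\<close> are Kraus operators, up to the weights, of the completely
  positive \<Phi> separating the contraction mixture from \<open>R\<close>. The second identity
  computes \<Phi>(1), which determines the cb-norm of \<Phi> by \<open>cb_bound_cp\<close>.\<close>

lemma contraction_mixture_dominated:
  fixes N n :: nat
  assumes lam: "\<forall>l<N. lam l \<ge> (0::real)" "(\<Sum>l<N. lam l) = 1"
    and A: "\<forall>l<N. A l \<in> carrier_mat n n" "\<forall>l<N. form_bound n (\<lambda>i j. A l $$ (i,j)) 1"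
  shows "\<exists>R\<in>conv_aut n. \<exists>B.
    (\<forall>p<n. \<forall>q<n. \<forall>r<n. \<forall>s<n. (\<Sum>l<N. complex_of_real (lam l) * (cnj (A l $$ (p,r)) * A l $$ (q,s))) =
       mapcoeff n R p q r s - (\<Sum>l<N. complex_of_real (lam l) * (cnj (B l p r) * B l q s))) \<and>
    (\<forall>r<n. \<forall>s<n. (\<Sum>l<N. complex_of_real (lam l) * (\<Sum>p<n. cnj (B l p r) * B l p s)) =
       (if r = s then 1 else 0) - (\<Sum>l<N. complex_of_real (lam l) * (\<Sum>p<n. cnj (A l $$ (p,r)) * A l $$ (p,s))))"
proof -
  define dil where "dil l W1 W2 B \<longleftrightarrow> unitary_mat n W1 \<and> unitary_mat n W2 \<and>
    (\<forall>p<n. \<forall>q<n. \<forall>r<n. \<forall>s<n. cnj (A l $$ (p,r)) * A l $$ (q,s) =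
       (cnj (W1 $$ (p,r)) * W1 $$ (q,s) + cnj (W2 $$ (p,r)) * W2 $$ (q,s)) / 2 - cnj (B $$ (p,r)) * B $$ (q,s)) \<and>
    (\<forall>r<n. \<forall>s<n. (\<Sum>p<n. cnj (B $$ (p,r)) * B $$ (p,s)) =
       (if r = s then 1 else 0) - (\<Sum>p<n. cnj (A l $$ (p,r)) * A l $$ (p,s)))" for l W1 W2 B
  have "\<exists>W1 W2 B. dil l W1 W2 B" if "l < N" for l
    unfolding dil_def by (rule contraction_unitary_dilation) (use A that in auto)
  then obtain W1 W2 B where "\<And>l. l < N \<Longrightarrow> dil l (W1 l) (W2 l) (B l)" by metis
  then have W: "\<And>l. l < N \<Longrightarrow> unitary_mat n (W1 l)" "\<And>l. l < N \<Longrightarrow> unitary_mat n (W2 l)"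
    and id: "\<And>l p q r s. \<lbrakk>l < N; p < n; q < n; r < n; s < n\<rbrakk> \<Longrightarrow> cnj (A l $$ (p,r)) * A l $$ (q,s) =
       (cnj (W1 l $$ (p,r)) * W1 l $$ (q,s) + cnj (W2 l $$ (p,r)) * W2 l $$ (q,s)) / 2 - cnj (B l $$ (p,r)) * B l $$ (q,s)"
    and BB: "\<And>l r s. \<lbrakk>l < N; r < n; s < n\<rbrakk> \<Longrightarrow> (\<Sum>p<n. cnj (B l $$ (p,r)) * B l $$ (p,s)) =
       (if r = s then 1 else 0) - (\<Sum>p<n. cnj (A l $$ (p,r)) * A l $$ (p,s))"
    unfolding dil_def by blast+
  \<comment> \<open>Each contraction yields two unitaries, at an even and at an odd index, which
    share its weight equally.\<close>
  define lam' where "lam' l = lam (l div 2) / 2" for l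
  define U where "U l = (if even l then W1 (l div 2) else W2 (l div 2))" for l
  have U: "unitary_mat n (U l)" if "l < N*2" for l
    using that W by (auto simp: U_def)
  have lam'0: "lam' l \<ge> 0" if "l < N*2" for l using that lam by (simp add: lam'_def)
  have two: "(\<Sum>r<2. f r) = f 0 + f (1::nat)" for f :: "nat \<Rightarrow> 'z::comm_monoid_add"
    by (simp add: numeral_2_eq_2)
  have lam'1: "(\<Sum>l<N*2. lam' l) = 1"
    unfolding sum_index_split two using lam by (simp add: lam'_def)
  define R where "R = mixture n (N*2) lam' U"
  have RC: "R \<in> conv_aut n" unfolding conv_aut_mixture R_def using U lam'0 lam'1 by blast
  have "(\<Sum>l<N. complex_of_real (lam l) * (cnj (A l $$ (p,r)) * A l $$ (q,s))) =
       mapcoeff n R p q r s - (\<Sum>l<N. complex_of_real (lam l) * (cnj (B l $$ (p,r)) * B l $$ (q,s)))"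
    if b: "p < n" "q < n" "r < n" "s < n" for p q r s
  proof -
    have "mapcoeff n R p q r s = (\<Sum>l<N. complex_of_real (lam l) / 2 * (cnj (W1 l $$ (p,r)) * W1 l $$ (q,s))
       + complex_of_real (lam l) / 2 * (cnj (W2 l $$ (p,r)) * W2 l $$ (q,s)))"
      unfolding R_def
      by (subst mixture_coeff[OF _ b]) (use U in \<open>simp_all add: sum_index_split two lam'_def U_def\<close>)
    moreover have "complex_of_real (lam l) * (cnj (A l $$ (p,r)) * A l $$ (q,s)) =
       (complex_of_real (lam l) / 2 * (cnj (W1 l $$ (p,r)) * W1 l $$ (q,s))
       + complex_of_real (lam l) / 2 * (cnj (W2 l $$ (p,r)) * W2 l $$ (q,s)))
       - complex_of_real (lam l) * (cnj (B l $$ (p,r)) * B l $$ (q,s))" if "l < N" for l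
      unfolding id[OF that b] by (simp add: field_simps)
    ultimately show ?thesis by (simp add: sum_subtractf[symmetric])
  qed
  moreover have "(\<Sum>l<N. complex_of_real (lam l) * (\<Sum>p<n. cnj (B l $$ (p,r)) * B l $$ (p,s))) =
       (if r = s then 1 else 0) - (\<Sum>l<N. complex_of_real (lam l) * (\<Sum>p<n. cnj (A l $$ (p,r)) * A l $$ (p,s)))"
    if b: "r < n" "s < n" for r s
  proof -
    have "(\<Sum>l<N. complex_of_real (lam l) * (\<Sum>p<n. cnj (B l $$ (p,r)) * B l $$ (p,s)))
      = (\<Sum>l<N. complex_of_real (lam l) * (if r = s then 1 else 0)
         - complex_of_real (lam l) * (\<Sum>p<n. cnj (A l $$ (p,r)) * A l $$ (p,s)))"
      using BB b by (intro sum.cong refl) (simp add: right_diff_distrib)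
    also have "\<dots> = (\<Sum>l<N. complex_of_real (lam l)) * (if r = s then 1 else 0)
        - (\<Sum>l<N. complex_of_real (lam l) * (\<Sum>p<n. cnj (A l $$ (p,r)) * A l $$ (p,s)))"
      by (simp add: sum_subtractf sum_distrib_right)
    also have "(\<Sum>l<N. complex_of_real (lam l)) = 1" using lam(2) by (simp flip: of_real_sum)
    finally show ?thesis by simp
  qed
  ultimately show ?thesis
    by (intro bexI[OF _ RC] exI[of _ "\<lambda>l i j. B l $$ (i,j)"]) auto
qed

text \<open>The sum condition on T is T(1) = 1 written in coefficients. S enters through its corner
  entry and \<open>closed_map\<close>, the two facts that \<open>tensor_pow_corner\<close> supplies
  when S is itself a tensor power of T.\<close>

lemma conv_aut_compress:
  assumes n: "n \<ge> 1" and k: "k \<ge> 1" and T: "closed_map n T" and S: "closed_map k S"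
    and Tu: "\<And>r s. r < n \<Longrightarrow> s < n \<Longrightarrow> (\<Sum>p<n. mapcoeff n T p p r s) = (if r = s then 1 else 0)"
    and S0: "mapcoeff k S 0 0 0 0 = 1" and R: "R \<in> conv_aut (n*k)"
  shows "\<exists>R'\<in>conv_aut n. cb_norm n (\<lambda>x. T x - R' x) \<le> 2 * cb_norm (n*k) (\<lambda>x. tensor_map n k T S x - R x)"
proof -
  have nk: "n*k \<ge> 1" using n k by simp
  define \<delta> where "\<delta> = cb_norm (n*k) (\<lambda>x. tensor_map n k T S x - R x)"
  note cl = closed_map_diff[OF closed_map_tensor_map R, of T S]
  have \<delta>0: "\<delta> \<ge> 0" unfolding \<delta>_def by (rule cb_norm_nonneg[OF cl nk])
  obtain N lam U where RU: "R = mixture (n*k) N lam U" and lam: "\<And>l. l < N \<Longrightarrow> lam l \<ge> 0" "(\<Sum>l<N. lam l) = 1"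
    and U: "\<And>l. l < N \<Longrightarrow> unitary_mat (n*k) (U l)"
    using R unfolding conv_aut_mixture by blast
  \<comment> \<open>The compression of \<open>U l\<close> by V, where \<open>i*k\<close> is the
    index of e_i \<otimes> e_0.\<close>
  define A where "A l = mat n n (\<lambda>(i,j). U l $$ (i*k,j*k))" for l
  have A: "A l \<in> carrier_mat n n" for l by (simp add: A_def)
  have Ac: "form_bound n (\<lambda>i j. A l $$ (i,j)) 1" if "l < N" for l
    using form_bound_subsample[OF k unitary_form_bound[OF U[OF that]]]
    by (subst form_bound_cong[where a' = "\<lambda>i j. U l $$ (i*k,j*k)"]) (auto simp: A_def)
  \<comment> \<open>The coefficients of T - R_V.\<close>
  define t1 where "t1 p q r s = mapcoeff n T p q r s - (\<Sum>l<N. complex_of_real (lam l) * (cnj (A l $$ (p,r)) * A l $$ (q,s)))" for p q r s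
  have t1: "cb_bound n t1 \<delta>"
  proof -
    have "cb_bound n (\<lambda>p q r s. mapcoeff (n*k) (\<lambda>x. tensor_map n k T S x - R x) (p*k) (q*k) (r*k) (s*k)) \<delta>"
      unfolding \<delta>_def by (rule cb_bound_compress[OF cb_bound_cb_norm[OF cl nk] k n])
    moreover have "mapcoeff (n*k) (\<lambda>x. tensor_map n k T S x - R x) (p*k) (q*k) (r*k) (s*k) = t1 p q r s"
      if b: "p < n" "q < n" "r < n" "s < n" for p q r s
    proof -
      have lt: "p*k < n*k" "q*k < n*k" "r*k < n*k" "s*k < n*k" using b k by auto
      have "mapcoeff (n*k) R (p*k) (q*k) (r*k) (s*k)
          = (\<Sum>l<N. complex_of_real (lam l) * (cnj (A l $$ (p,r)) * A l $$ (q,s)))"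
        unfolding RU by (subst mixture_coeff[OF _ lt]) (use U b in \<open>auto simp: A_def\<close>)
      then show ?thesis
        unfolding mapcoeff_diff[OF R lt(3,4), where T = "tensor_map n k T S"]
          tensor_map_corner[OF T S k b] S0 t1_def by simp
    qed
    ultimately show ?thesis by (subst cb_bound_cong[OF _ n, symmetric]) auto
  qed
  from contraction_mixture_dominated[of N lam A n] lam A Ac
  obtain R' B where R': "R' \<in> conv_aut n" and
    e: "\<forall>p<n. \<forall>q<n. \<forall>r<n. \<forall>s<n. (\<Sum>l<N. complex_of_real (lam l) * (cnj (A l $$ (p,r)) * A l $$ (q,s))) =
       mapcoeff n R' p q r s - (\<Sum>l<N. complex_of_real (lam l) * (cnj (B l p r) * B l q s))" and
    G: "\<forall>r<n. \<forall>s<n. (\<Sum>l<N. complex_of_real (lam l) * (\<Sum>p<n. cnj (B l p r) * B l p s)) =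
       (if r = s then 1 else 0) - (\<Sum>l<N. complex_of_real (lam l) * (\<Sum>p<n. cnj (A l $$ (p,r)) * A l $$ (p,s)))"
    by auto
  have "form_bound n (\<lambda>r s. \<Sum>l<N. complex_of_real (lam l) * (\<Sum>p<n. cnj (B l p r) * B l p s)) \<delta>"
  proof -
    \<comment> \<open>T - R_V is evaluated at the identity, with m = 1; since T(1) = 1, the value is
      1 - R_V(1) = \<Phi>(1).\<close>
    have "form_bound n (amp n t1 (\<lambda>i j. if i = j then 1 else 0)) \<delta>"
      using cb_boundD[OF t1, of 1] form_bound_identity[of n] by simp
    moreover have "amp n t1 (\<lambda>i j. if i = j then 1 else 0) r s
        = (\<Sum>l<N. complex_of_real (lam l) * (\<Sum>p<n. cnj (B l p r) * B l p s))" if b: "r < n" "s < n" for r s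
    proof -
      have "amp n t1 (\<lambda>i j. if i = j then 1 else 0) r s = (\<Sum>p<n. \<Sum>q<n. if q = p then t1 p p r s else 0)"
        unfolding amp_def using b by (intro sum.cong refl) auto
      also have "\<dots> = (\<Sum>p<n. t1 p p r s)" by simp
      also have "\<dots> = (if r = s then 1 else 0) - (\<Sum>p<n. \<Sum>l<N. complex_of_real (lam l) * (cnj (A l $$ (p,r)) * A l $$ (p,s)))"
        unfolding t1_def sum_subtractf Tu[OF b] ..
      also have "(\<Sum>p<n. \<Sum>l<N. complex_of_real (lam l) * (cnj (A l $$ (p,r)) * A l $$ (p,s)))
         = (\<Sum>l<N. complex_of_real (lam l) * (\<Sum>p<n. cnj (A l $$ (p,r)) * A l $$ (p,s)))"
        unfolding sum_distrib_left by (rule sum.swap)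
      finally show ?thesis using G b by simp
    qed
    ultimately show ?thesis by (subst form_bound_cong[symmetric]) auto
  qed
  \<comment> \<open>T - R' = (T - R_V) - \<Phi>, and both summands have cb-bound \<delta>.\<close>
  then have "cb_bound n (\<lambda>p q r s. t1 p q r s + - (\<Sum>l<N. complex_of_real (lam l) * (cnj (B l p r) * B l q s))) (\<delta> + \<delta>)"
    using lam by (intro cb_bound_add[OF t1] cb_bound_cp) auto
  then have "cb_bound n (mapcoeff n (\<lambda>x. T x - R' x)) (\<delta> + \<delta>)"
    by (subst cb_bound_cong[OF _ n]) (auto simp: mapcoeff_diff[OF R'] t1_def e)
  then have "cb_norm n (\<lambda>x. T x - R' x) \<le> \<delta> + \<delta>"
    using cb_norm_le_iff[OF closed_map_diff[OF T R'] n, of "\<delta> + \<delta>"] \<delta>0 by simp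
  then show ?thesis using R' unfolding \<delta>_def by (intro bexI[of _ R']) auto
qed

lemma d_cb_tensor_map_ge:
  assumes "n \<ge> 1" "k \<ge> 1" "closed_map n T" "closed_map k S"
    and "\<And>r s. r < n \<Longrightarrow> s < n \<Longrightarrow> (\<Sum>p<n. mapcoeff n T p p r s) = (if r = s then 1 else 0)"
    and "mapcoeff k S 0 0 0 0 = 1"
  shows "d_cb (n*k) (tensor_map n k T S) (conv_aut (n*k)) \<ge> 1/2 * d_cb n T (conv_aut n)"
  unfolding d_cb_def[of "n*k"]
proof (rule cInf_greatest)
  show "{cb_norm (n * k) (\<lambda>x. tensor_map n k T S x - R x) |R. R \<in> conv_aut (n * k)} \<noteq> {}"
    using conv_aut_nonempty by auto
  fix c assume "c \<in> {cb_norm (n * k) (\<lambda>x. tensor_map n k T S x - R x) |R. R \<in> conv_aut (n * k)}"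
  then obtain R where R: "R \<in> conv_aut (n*k)" "c = cb_norm (n * k) (\<lambda>x. tensor_map n k T S x - R x)" by blast
  then obtain R' where "R' \<in> conv_aut n" "cb_norm n (\<lambda>x. T x - R' x) \<le> 2 * c"
    using conv_aut_compress[OF assms R(1)] by auto
  then show "1/2 * d_cb n T (conv_aut n) \<le> c"
    using d_cb_le[OF assms(3,1)] by fastforce
qed

section \<open>Schur multipliers, tensor powers and the limit\<close>

lemma
  assumes "UCPT_schur d T"
  shows UCPT_schur_closed: "closed_map d T"
    and UCPT_schur_apply: "\<lbrakk>x \<in> carrier_mat d d; r < d; s < d\<rbrakk> \<Longrightarrow> T x $$ (r,s) = mapcoeff d T r s r s * x $$ (r,s)"
    and UCPT_schur_off: "\<lbrakk>r < d; s < d; \<not> (p = r \<and> q = s)\<rbrakk> \<Longrightarrow> mapcoeff d T p q r s = 0"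
    and UCPT_schur_diag: "r < d \<Longrightarrow> mapcoeff d T r r r r = 1"
proof -
  obtain B where B: "\<And>x. x \<in> carrier_mat d d \<Longrightarrow> T x = mat d d (\<lambda>(i,j). B $$ (i,j) * x $$ (i,j))"
    and T1: "T (1\<^sub>m d) = 1\<^sub>m d"
    using assms by (auto simp: UCPT_schur_def UCPT_def)
  have mu: "munit d p q \<in> carrier_mat d d" for p q by (simp add: munit_def)
  have e: "T x $$ (r,s) = B $$ (r,s) * x $$ (r,s)" if "x \<in> carrier_mat d d" "r < d" "s < d" for x r s
    using that by (simp add: B)
  have c: "mapcoeff d T p q r s = (if p = r \<and> q = s then B $$ (r,s) else 0)" if "r < d" "s < d" for p q r s
    unfolding e[OF mu that] using that by (auto simp: munit_def)
  show "closed_map d T" by (simp add: closed_map_def B[OF mu])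
  show "T x $$ (r,s) = mapcoeff d T r s r s * x $$ (r,s)" if "x \<in> carrier_mat d d" "r < d" "s < d"
    using that by (simp add: c e)
  show "mapcoeff d T p q r s = 0" if "r < d" "s < d" "\<not> (p = r \<and> q = s)"
    using that by (auto simp: c)
  \<comment> \<open>The diagonal of the multiplier is read off from T(1) = 1.\<close>
  show "mapcoeff d T r r r r = 1" if "r < d"
    using e[of "1\<^sub>m d" r r] that by (simp add: T1 c)
qed

text \<open>Distance 0 provides mixtures within 1/(j+1) of T. Their coefficients converge to those
  of T by \<open>cb_bound_entry\<close>, so \<open>conv_aut_closed\<close> gives a mixture with the
  coefficients of T, and linearity extends the equality to all matrices.\<close>

lemma in_conv_aut_if_d_cb_0:
  assumes n: "n \<ge> 1" and T: "closed_map n T" and d0: "d_cb n T (conv_aut n) = 0"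
    and lin: "\<And>x r s. x \<in> carrier_mat n n \<Longrightarrow> r < n \<Longrightarrow> s < n \<Longrightarrow>
        T x $$ (r,s) = (\<Sum>p<n. \<Sum>q<n. x $$ (p,q) * mapcoeff n T p q r s)"
    and car: "\<And>x. x \<in> carrier_mat n n \<Longrightarrow> T x \<in> carrier_mat n n"
  shows "in_conv_aut n T"
proof -
  have "\<exists>R\<in>conv_aut n. cb_norm n (\<lambda>x. T x - R x) < 1 / real (Suc j)" for j
  proof -
    have "Inf {cb_norm n (\<lambda>x. T x - R x) |R. R \<in> conv_aut n} < 1 / real (Suc j)"
      using d0 by (simp add: d_cb_def)
    from cInf_lessD[OF _ this] show ?thesis using conv_aut_nonempty by auto
  qed
  then obtain R where R: "\<And>j. R j \<in> conv_aut n" "\<And>j. cb_norm n (\<lambda>x. T x - R j x) < 1 / real (Suc j)" by metis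
  have lim: "(\<lambda>j. mapcoeff n (R j) p q r s) \<longlonglongrightarrow> mapcoeff n T p q r s" if b: "p < n" "q < n" "r < n" "s < n" for p q r s
  proof -
    have le: "cmod (mapcoeff n T p q r s - mapcoeff n (R j) p q r s) \<le> 1 / real (Suc j)" for j
      using cb_bound_entry[OF cb_bound_cb_norm[OF closed_map_diff[OF T R(1)] n] b, of j] R(2)[of j]
      unfolding mapcoeff_diff[OF R(1) b(3,4)] by linarith
    have "(\<lambda>j. cmod (mapcoeff n T p q r s - mapcoeff n (R j) p q r s)) \<longlonglongrightarrow> 0"
    proof (rule tendsto_sandwich[where f = "\<lambda>_. 0" and h = "\<lambda>j. 1 / real (Suc j)"])
      show "(\<lambda>j. 1 / real (Suc j)) \<longlonglongrightarrow> 0" by (rule LIMSEQ_Suc[OF lim_1_over_n])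
      show "\<forall>\<^sub>F j in sequentially. cmod (mapcoeff n T p q r s - mapcoeff n (R j) p q r s) \<le> 1 / real (Suc j)"
        using le by (intro always_eventually allI)
      show "\<forall>\<^sub>F j in sequentially. 0 \<le> cmod (mapcoeff n T p q r s - mapcoeff n (R j) p q r s)" by simp
    qed simp
    then have "(\<lambda>j. mapcoeff n T p q r s - mapcoeff n (R j) p q r s) \<longlonglongrightarrow> 0"
      by (rule tendsto_norm_zero_cancel)
    from tendsto_diff[OF tendsto_const[of "mapcoeff n T p q r s"] this] show ?thesis by simp
  qed
  have "\<exists>R'\<in>conv_aut n. \<forall>p<n. \<forall>q<n. \<forall>r<n. \<forall>s<n. mapcoeff n R' p q r s = mapcoeff n T p q r s"
    by (rule conv_aut_closed[where R = R and t = "mapcoeff n T"]) (rule R(1), rule lim)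
  then obtain R' where R': "R' \<in> conv_aut n"
    and co: "\<And>p q r s. \<lbrakk>p < n; q < n; r < n; s < n\<rbrakk> \<Longrightarrow> mapcoeff n R' p q r s = mapcoeff n T p q r s"
    by blast
  have "T x = R' x" if x: "x \<in> carrier_mat n n" for x
  proof (rule eq_matI)
    note R'x = conv_aut_carrier[OF R', of x]
    then show "dim_row (T x) = dim_row (R' x)" "dim_col (T x) = dim_col (R' x)"
      using car[OF x] by auto
    fix r s assume "r < dim_row (R' x)" "s < dim_col (R' x)"
    then have rs: "r < n" "s < n" using R'x by auto
    show "T x $$ (r,s) = R' x $$ (r,s)"
      using rs by (simp add: lin[OF x rs] conv_aut_apply[OF R' x rs] co)
  qed
  then show ?thesis using R' unfolding in_conv_aut_def by blast
qed

lemma tensor_pow_corner: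
  assumes n: "n \<ge> 1" and T: "closed_map n T" and T0: "mapcoeff n T 0 0 0 0 = 1"
  shows "closed_map (n^k) (tensor_pow n k T) \<and> mapcoeff (n^k) (tensor_pow n k T) 0 0 0 0 = 1"
proof (induction k)
  case 0
  show ?case by (simp add: closed_map_def munit_def)
next
  case (Suc k)
  \<comment> \<open>The index 0 is written as \<open>0 * n^k\<close> to match the shape of
    \<open>tensor_map_corner\<close>.\<close>
  have "mapcoeff (n * n^k) (tensor_map n (n^k) T (tensor_pow n k T)) (0 * n^k) (0 * n^k) (0 * n^k) (0 * n^k) = 1"
    using Suc n T0 by (subst tensor_map_corner[OF T]) auto
  then show ?case using closed_map_tensor_map[of n "n^k" T "tensor_pow n k T"] by simp
qed

theorem theorem2p4:
  fixes n k :: nat and T S :: "complex mat \<Rightarrow> complex mat"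
  assumes "n \<ge> 1" and "k \<ge> 1"
    and "UCPT_schur n T" and "UCPT_schur k S"
  shows "d_cb (n*k) (tensor_map n k T S) (conv_aut (n*k)) \<ge> 1/2 * d_cb n T (conv_aut n)
         \<and> (\<not> in_conv_aut n T \<longrightarrow> \<not> asymptotic_QBP n T)"
proof -
  note T = UCPT_schur_closed[OF assms(3)] and S = UCPT_schur_closed[OF assms(4)]
  have Tu: "(\<Sum>p<n. mapcoeff n T p p r s) = (if r = s then 1 else 0)" if "r < n" "s < n" for r s
  proof -
    have "(\<Sum>p<n. mapcoeff n T p p r s) = (\<Sum>p<n. if p = r then (if r = s then 1 else 0) else 0)"
      using that by (intro sum.cong refl) (auto simp: UCPT_schur_off[OF assms(3)] UCPT_schur_diag[OF assms(3)])
    then show ?thesis using that by simp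
  qed
  have T0: "mapcoeff n T 0 0 0 0 = 1" using assms(1) by (simp add: UCPT_schur_diag[OF assms(3)])
  have S0: "mapcoeff k S 0 0 0 0 = 1" using assms(2) by (simp add: UCPT_schur_diag[OF assms(4)])
  have "in_conv_aut n T" if "asymptotic_QBP n T"
  proof (rule in_conv_aut_if_d_cb_0[OF assms(1) T])
    \<comment> \<open>The power with exponent \<open>Suc j\<close> is T \<otimes> S, where S is the
      tensor power with exponent j, so the estimate holds from exponent 1 on; the shift by one
      leaves the limit unchanged.\<close>
    have "1/2 * d_cb n T (conv_aut n) \<le> d_cb (n^Suc j) (tensor_pow n (Suc j) T) (conv_aut (n^Suc j))" for j
      using d_cb_tensor_map_ge[OF assms(1) _ T _ Tu, of "n^j" "tensor_pow n j T"] assms(1)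
        tensor_pow_corner[OF assms(1) T T0, of j] by simp
    moreover have "(\<lambda>j. d_cb (n^Suc j) (tensor_pow n (Suc j) T) (conv_aut (n^Suc j))) \<longlonglongrightarrow> 0"
      using that unfolding asymptotic_QBP_def by (rule LIMSEQ_Suc)
    ultimately have "1/2 * d_cb n T (conv_aut n) \<le> 0"
      by (intro LIMSEQ_le_const) auto
    then show "d_cb n T (conv_aut n) = 0" using d_cb_nonneg[OF T assms(1)] by simp
    show "T x $$ (r,s) = (\<Sum>p<n. \<Sum>q<n. x $$ (p,q) * mapcoeff n T p q r s)"
      if "x \<in> carrier_mat n n" "r < n" "s < n" for x r s
    proof -
      have "(\<Sum>p<n. \<Sum>q<n. x $$ (p,q) * mapcoeff n T p q r s)
        = (\<Sum>p<n. \<Sum>q<n. if q = s then if p = r then mapcoeff n T r s r s * x $$ (r,s) else 0 else 0)"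
        using that by (intro sum.cong refl) (auto simp: UCPT_schur_off[OF assms(3)])
      then show ?thesis using that by (simp add: UCPT_schur_apply[OF assms(3)])
    qed
    show "T x \<in> carrier_mat n n" if "x \<in> carrier_mat n n" for x
      using assms(3) that by (auto simp: UCPT_schur_def UCPT_def linear_on_def)
  qed
  then show ?thesis using d_cb_tensor_map_ge[OF assms(1,2) T S Tu S0] by blast
qed

end
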